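(* Let $T_I=(A^I,b^I,c^I)$ be a Runge–Kutta method with $s^I$ stages (the inner base method) and let $T_O=(A^O,b^O,c^O)$ be an explicit Runge–Kutta method with $s^O$ stages (the outer base method) with $c_1^O=0$, $c_i^O\le c_j^O$ for $i<j$, and $c_{s^O}^O\le 1$. Assume that $T_I$ has order at least three, that $T_O$ has order at least four, that both satisfy the row-sum consistency conditions $c_i=\sum_j a_{i,j}$, and that $$v^{O\intercal}A^Oc^O=\frac1{12},$$ where $v^O\in\mathbb{R}^{s^O}$ is given by $$v_i^O=\begin{cases}0,& i=1,\\ b_i^O\left(c_i^O-c_{i-1}^O\right)+\left(c_{i+1}^O-c_{i-1}^O\right)\sum_{j=i+1}^{s^O}b_j^O,& 1<i<s^O,\\ b_{s^O}^O\left(c_{s^O}^O-c_{s^O-1}^O\right),& i=s^O.\end{cases}$$ Let the fast solution coefficients be $$\mathbf{b}^{\{f\}\intercal}=\left[\,b_1^O\boldsymbol{\epsilon}_1^{\intercal}\ \ b_2^O\boldsymbol{\epsilon}_1^{\intercal}\ \ \cdots\ \ b_{s^O}^O\boldsymbol{\epsilon}_1^{\intercal}\,\right]\in\mathbb{R}^{s^Os^I},$$ where $\boldsymbol{\epsilon}_1$ is the first standard basis vector of $\mathbb{R}^{s^I}$. If the first stage of $T_I$ is explicit (the first entry of $c^I$ and the first row of $A^I$ are zero), then the RMIS method, i.e. the two-component GARK method with coefficients $\mathbf{A}^{\{f,f\}},\mathbf{A}^{\{f,s\}},\mathbf{A}^{\{s,f\}},\mathbf{A}^{\{s,s\}},\mathbf{b}^{\{s\}}$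 built from $T_I$ and $T_O$ together with this $\mathbf{b}^{\{f\}}$, is fourth-order accurate.
   Context: A Runge–Kutta method with $s$ stages is a triple $(A,b,c)$ with $A=(a_{i,j})\in\mathbb{R}^{s\times s}$ and $b,c\in\mathbb{R}^s$. It is explicit if $A$ is strictly lower triangular. Order is the classical Runge–Kutta order: with $c=A\mathbb{1}$, order at least three means $b^\intercal\mathbb{1}=1$, $b^\intercal c=\frac12$, $b^\intercal(c\times c)=\frac13$, $b^\intercal Ac=\frac16$; order at least four means that in addition $b^\intercal(c\times c\times c)=\frac14$, $(b\times c)^\intercal Ac=\frac18$, $b^\intercal A(c\times c)=\frac1{12}$, $b^\intercal AAc=\frac1{24}$. Notation: $\times$ between vectors is the component-wise product; $\mathbb{1}$ denotes a column vector of ones, and $\mathbb{1}^{\{s^I\}}$ the one in $\mathbb{R}^{s^I}$; $\mathbf{e}_i$ is the $i$-th standard basis vector of $\mathbb{R}^{s^O}$; $\mathbf{g}_i\in\mathbb{R}^{s^O}$ has entries $[\mathbf{g}_i]_j=0$ for $j<i$ and $[\mathbf{g}_i]_j=1$ for $j\ge i$. RMIS coefficients built from $T_I$ and $T_O$: slow stages are indexed by $1,\dots,s^{\{s\}}=s^O$; fast stages are organized in $s^O$ blocks of $s^I$ stages each, $s^{\{f\}}=s^f=s^Os^I$. Put $c^O_{s^O+1}:=1$. Then: - $\mathbf{A}^{\{s,s\}}=A^O$, $\mathbf{b}^{\{s\}}=b^O$, $\mathbf{c}^{\{s\}}=c^O$. - $\mathbf{A}^{\{f,f\}}\in\mathbb{R}^{s^f\times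 s^f}$ is block lower triangular; its $(i,j)$ block ($1\le i,j\le s^O$) is $(c_{j+1}^O-c_j^O)\,\mathbb{1}^{\{s^I\}}b^{I\intercal}$ if $j<i$, $(c_{i+1}^O-c_i^O)A^I$ if $j=i$, and $0$ if $j>i$. - $\mathbf{A}^{\{s,f\}}\in\mathbb{R}^{s^O\times s^f}$ has $j$-th block column $(c_{j+1}^O-c_j^O)\mathbf{g}_{j+1}b^{I\intercal}$ for $j<s^O$ and zero for $j=s^O$. - $\mathbf{A}^{\{f,s\}}\in\mathbb{R}^{s^f\times s^O}$ has $i$-th block row $\mathbb{1}^{\{s^I\}}\mathbf{e}_i^\intercal A^O+c^I(\mathbf{e}_{i+1}-\mathbf{e}_i)^\intercal A^O$ for $1\le i<s^O$ (for $i=1$ this is $c^I\mathbf{e}_2^\intercal A^O$ since $T_O$ is explicit), and $\mathbb{1}^{\{s^I\}}\mathbf{e}_{s^O}^\intercal A^O+c^I(b^{O\intercal}-\mathbf{e}_{s^O}^\intercal A^O)$ for $i=s^O$. - The abscissae $\mathbf{c}^{\{f\}}\in\mathbb{R}^{s^f}$ have $i$-th block $c_i^O\mathbb{1}^{\{s^I\}}+(c_{i+1}^O-c_i^O)c^I$, $1\le i\le s^O$. GARK method: for an autonomous system $y'=f^{\{f\}}(y)+f^{\{s\}}(y)$, $y(t)\in\mathbb{R}^n$, one step of size $h$ of the two-component GARK method with these coefficients takes $y_n$ to $y_{n+1}$ by $$k^{\{q\}}_j=y_n+h\sum_{l=1}^{s^{\{f\}}}a^{\{q,f\}}_{j,l}f^{\{f\}}(k^{\{f\}}_l)+h\sum_{l=1}^{s^{\{s\}}}a^{\{q,s\}}_{j,l}f^{\{s\}}(k^{\{s\}}_l),\quad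 j=1,\dots,s^{\{q\}},\ q\in\{f,s\},$$ $$y_{n+1}=y_n+h\sum_{l=1}^{s^{\{f\}}}b^{\{f\}}_lf^{\{f\}}(k^{\{f\}}_l)+h\sum_{l=1}^{s^{\{s\}}}b^{\{s\}}_lf^{\{s\}}(k^{\{s\}}_l),$$ where $a^{\{q,r\}}_{j,l}$ are the entries of $\mathbf{A}^{\{q,r\}}$ (if $T_I$ is implicit, the stages are, for small $h$, the solution of the stage equations tending to $y_n$ as $h\to0$). Fourth-order accurate has the usual meaning: for all sufficiently smooth $f^{\{f\}},f^{\{s\}}$, the local error after one step started from an exact value $y_n=y(t_n)$ satisfies $y_{n+1}-y(t_n+h)=O(h^5)$ as $h\to0$. *)

theory Defs
  imports "HOL-Analysis.Analysis" "HOL-Library.Landau_Symbols"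
begin

section \<open>Runge--Kutta methods\<close>

text \<open>
  Stages are numbered from 1 to \<open>rk_s\<close>; entries with indices outside that range are junk
  and are never referred to.
\<close>

record rk =
  rk_s :: nat
  rk_A :: "nat \<Rightarrow> nat \<Rightarrow> real"
  rk_b :: "nat \<Rightarrow> real"
  rk_c :: "nat \<Rightarrow> real"

definition rk_explicit :: "rk \<Rightarrow> bool" where
  "rk_explicit M \<longleftrightarrow> (\<forall>i\<in>{1..rk_s M}. \<forall>j\<in>{1..rk_s M}. i \<le> j \<longrightarrow> rk_A M i j = 0)"

definition rk_row_sum :: "rk \<Rightarrow> bool" where
  "rk_row_sum M \<longleftrightarrow> (\<forall>i\<in>{1..rk_s M}. rk_c M i = (\<Sum>j=1..rk_s M. rk_A M i j))"

text \<open>Matrix-vector product, for the matrix of coefficients of \<open>M\<close>.\<close>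

definition rk_Av :: "rk \<Rightarrow> (nat \<Rightarrow> real) \<Rightarrow> nat \<Rightarrow> real" where
  "rk_Av M u i = (\<Sum>j=1..rk_s M. rk_A M i j * u j)"

definition rk_order_ge_3 :: "rk \<Rightarrow> bool" where
  "rk_order_ge_3 M \<longleftrightarrow>
     (\<Sum>i=1..rk_s M. rk_b M i) = 1 \<and>
     (\<Sum>i=1..rk_s M. rk_b M i * rk_c M i) = 1 / 2 \<and>
     (\<Sum>i=1..rk_s M. rk_b M i * rk_c M i ^ 2) = 1 / 3 \<and>
     (\<Sum>i=1..rk_s M. rk_b M i * rk_Av M (rk_c M) i) = 1 / 6"

definition rk_order_ge_4 :: "rk \<Rightarrow> bool" where
  "rk_order_ge_4 M \<longleftrightarrow> rk_order_ge_3 M \<and>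
     (\<Sum>i=1..rk_s M. rk_b M i * rk_c M i ^ 3) = 1 / 4 \<and>
     (\<Sum>i=1..rk_s M. rk_b M i * rk_c M i * rk_Av M (rk_c M) i) = 1 / 8 \<and>
     (\<Sum>i=1..rk_s M. rk_b M i * rk_Av M (\<lambda>j. rk_c M j ^ 2) i) = 1 / 12 \<and>
     (\<Sum>i=1..rk_s M. rk_b M i * rk_Av M (rk_Av M (rk_c M)) i) = 1 / 24"

section \<open>Two-component GARK methods\<close>

text \<open>
  The fast and slow stages are indexed by finite sets \<open>gark_F\<close> and \<open>gark_S\<close>. The coefficient
  \<open>gark_Aqr\<close> is the matrix $\mathbf{A}^{\{q,r\}}$.
\<close>

record ('f, 's) gark =
  gark_F :: "'f set"
  gark_S :: "'s set"
  gark_Aff :: "'f \<Rightarrow> 'f \<Rightarrow> real"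
  gark_Afs :: "'f \<Rightarrow> 's \<Rightarrow> real"
  gark_Asf :: "'s \<Rightarrow> 'f \<Rightarrow> real"
  gark_Ass :: "'s \<Rightarrow> 's \<Rightarrow> real"
  gark_bf :: "'f \<Rightarrow> real"
  gark_bs :: "'s \<Rightarrow> real"

definition gark_stages ::
  "('f, 's) gark \<Rightarrow> (real^'n \<Rightarrow> real^'n) \<Rightarrow> (real^'n \<Rightarrow> real^'n) \<Rightarrow> real \<Rightarrow> real^'n
    \<Rightarrow> ('f \<Rightarrow> real^'n) \<Rightarrow> ('s \<Rightarrow> real^'n) \<Rightarrow> bool" where
  "gark_stages G ff fs h y0 kf ks \<longleftrightarrow>
     (\<forall>j\<in>gark_F G. kf j = y0 + h *\<^sub>R (\<Sum>l\<in>gark_F G. gark_Aff G j l *\<^sub>R ff (kf l))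
                            + h *\<^sub>R (\<Sum>l\<in>gark_S G. gark_Afs G j l *\<^sub>R fs (ks l))) \<and>
     (\<forall>j\<in>gark_S G. ks j = y0 + h *\<^sub>R (\<Sum>l\<in>gark_F G. gark_Asf G j l *\<^sub>R ff (kf l))
                            + h *\<^sub>R (\<Sum>l\<in>gark_S G. gark_Ass G j l *\<^sub>R fs (ks l)))"

definition gark_step ::
  "('f, 's) gark \<Rightarrow> (real^'n \<Rightarrow> real^'n) \<Rightarrow> (real^'n \<Rightarrow> real^'n) \<Rightarrow> real \<Rightarrow> real^'n
    \<Rightarrow> ('f \<Rightarrow> real^'n) \<Rightarrow> ('s \<Rightarrow> real^'n) \<Rightarrow> real^'n" where
  "gark_step G ff fs h y0 kf ks =
     y0 + h *\<^sub>R (\<Sum>l\<in>gark_F G. gark_bf G l *\<^sub>R ff (kf l))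
        + h *\<^sub>R (\<Sum>l\<in>gark_S G. gark_bs G l *\<^sub>R fs (ks l))"

text \<open>
  Stage values as functions of the step size: for all small \<open>h > 0\<close> they solve the stage
  equations, and they tend to \<open>y0\<close>. For explicit methods the second condition is automatic;
  for implicit ones it selects the right solution.
\<close>

definition gark_stage_family ::
  "('f, 's) gark \<Rightarrow> (real^'n \<Rightarrow> real^'n) \<Rightarrow> (real^'n \<Rightarrow> real^'n) \<Rightarrow> real^'n
    \<Rightarrow> (real \<Rightarrow> 'f \<Rightarrow> real^'n) \<Rightarrow> (real \<Rightarrow> 's \<Rightarrow> real^'n) \<Rightarrow> bool" where
  "gark_stage_family G ff fs y0 kf ks \<longleftrightarrow>
     (\<forall>\<^sub>F h in at_right 0. gark_stages G ff fs h y0 (kf h) (ks h)) \<and>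
     (\<forall>j\<in>gark_F G. ((\<lambda>h. kf h j) \<longlongrightarrow> y0) (at_right 0)) \<and>
     (\<forall>j\<in>gark_S G. ((\<lambda>h. ks h j) \<longlongrightarrow> y0) (at_right 0))"

text \<open>
  The class $C^m$ on the whole space. Directional derivatives keep the type of the function
  fixed along the recursion; in finite dimension, where the definition is used, this is
  $m$-fold continuous (Frechet) differentiability.
\<close>

primrec C_diff :: "nat \<Rightarrow> (real^'n \<Rightarrow> real^'n) \<Rightarrow> bool" where
  "C_diff 0 f \<longleftrightarrow> continuous_on UNIV f"
| "C_diff (Suc m) f \<longleftrightarrow>
     (\<forall>x. f differentiable (at x)) \<and> (\<forall>v. C_diff m (\<lambda>x. frechet_derivative f (at x) v))"

text \<open>
  Accuracy of order \<open>p\<close> on systems in $\mathbb{R}^n$: for all sufficiently smooth right-hand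
  sides and every exact solution \<open>y\<close> on some \<open>[t0, t0 + d]\<close>, the stages exist for small step
  sizes and the local error is $O(h^{p+1})$. The existence clause only expresses that the
  step is well defined, so that the error bound is not vacuous for implicit methods.
\<close>

definition gark_accurate :: "'n::finite itself \<Rightarrow> nat \<Rightarrow> ('f, 's) gark \<Rightarrow> bool" where
  "gark_accurate (_ :: 'n itself) p G \<longleftrightarrow>
     (\<exists>m. \<forall>(ff :: real^'n \<Rightarrow> real^'n) (fs :: real^'n \<Rightarrow> real^'n) y t0 d.
        C_diff m ff \<longrightarrow> C_diff m fs \<longrightarrow> d > 0 \<longrightarrow>
        (\<forall>t\<in>{t0..t0 + d}.
           (y has_vector_derivative (ff (y t) + fs (y t))) (at t within {t0..t0 + d})) \<longrightarrow>
        (\<exists>kf ks. gark_stage_family G ff fs (y t0) kf ks) \<and>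
        (\<forall>kf ks. gark_stage_family G ff fs (y t0) kf ks \<longrightarrow>
           (\<lambda>h. norm (gark_step G ff fs h (y t0) (kf h) (ks h) - y (t0 + h)))
             \<in> O[at_right 0](\<lambda>h. h ^ (p + 1))))"

section \<open>RMIS coefficients\<close>

text \<open>
  \<open>TI\<close> is the inner and \<open>TO\<close> the outer base method. The fast stage \<open>(i, k)\<close> is the \<open>k\<close>-th
  stage of the \<open>i\<close>-th block.
\<close>

definition rmis_dc :: "rk \<Rightarrow> nat \<Rightarrow> real" where
  "rmis_dc TO i = (if i = rk_s TO then 1 else rk_c TO (i + 1)) - rk_c TO i"

definition rmis_Aff :: "rk \<Rightarrow> rk \<Rightarrow> nat \<times> nat \<Rightarrow> nat \<times> nat \<Rightarrow> real" where
  "rmis_Aff TI TO = (\<lambda>(i, k) (j, l).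
     if j < i then rmis_dc TO j * rk_b TI l
     else if j = i then rmis_dc TO i * rk_A TI k l
     else 0)"

definition rmis_g :: "nat \<Rightarrow> nat \<Rightarrow> real" where
  "rmis_g i j = (if j < i then 0 else 1)"

definition rmis_Asf :: "rk \<Rightarrow> rk \<Rightarrow> nat \<Rightarrow> nat \<times> nat \<Rightarrow> real" where
  "rmis_Asf TI TO = (\<lambda>i (j, l).
     if j < rk_s TO then rmis_dc TO j * rmis_g (j + 1) i * rk_b TI l else 0)"

definition rmis_Afs :: "rk \<Rightarrow> rk \<Rightarrow> nat \<times> nat \<Rightarrow> nat \<Rightarrow> real" where
  "rmis_Afs TI TO = (\<lambda>(i, k) j.
     rk_A TO i j +
       rk_c TI k * ((if i < rk_s TO then rk_A TO (i + 1) j else rk_b TO j) - rk_A TO i j))"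

definition rmis :: "rk \<Rightarrow> rk \<Rightarrow> (nat \<times> nat \<Rightarrow> real) \<Rightarrow> (nat \<times> nat, nat) gark" where
  "rmis TI TO bf = \<lparr>
     gark_F = {1..rk_s TO} \<times> {1..rk_s TI},
     gark_S = {1..rk_s TO},
     gark_Aff = rmis_Aff TI TO,
     gark_Afs = rmis_Afs TI TO,
     gark_Asf = rmis_Asf TI TO,
     gark_Ass = rk_A TO,
     gark_bf = bf,
     gark_bs = rk_b TO\<rparr>"

definition rmis_bf :: "rk \<Rightarrow> nat \<times> nat \<Rightarrow> real" where
  "rmis_bf TO = (\<lambda>(i, k). if k = 1 then rk_b TO i else 0)"

definition rmis_v :: "rk \<Rightarrow> nat \<Rightarrow> real" where
  "rmis_v TO i =
     (if i = 1 then 0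
      else if i < rk_s TO then
        rk_b TO i * (rk_c TO i - rk_c TO (i - 1)) +
        (rk_c TO (i + 1) - rk_c TO (i - 1)) * (\<Sum>j=i+1..rk_s TO. rk_b TO j)
      else rk_b TO i * (rk_c TO i - rk_c TO (i - 1)))"

end

theory Submission
  imports Defs
begin

text \<open>
  As the first inner stage is explicit, the first stage of the \<open>i\<close>-th fast block satisfies the same equation
  as the \<open>i\<close>-th slow stage. The method is therefore an additive Runge--Kutta method on the fast stages,
  with the same weights for both parts of the right-hand side.

  Let $P$ be the fourth Taylor polynomial of the exact solution. The deviation of stage $j$ from $P(c_j h)$
  is expanded up to $O(h^4)$; its coefficients are linear in the defects
  $\sum_m a^{\{q\}}_{j,m} c_m^k - c_j^{k+1}/(k+1)$. Since the $h$-coefficient vanishes by row-sum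
  consistency, the local error is $O(h^5)$ once the weights form a quadrature of order four and
  annihilate a few linear expressions in these defects. This replaces the enumeration of coloured trees.
\<close>

section \<open>Vector-valued $O(h^k)$ as $h$ tends to 0 from the right\<close>

text \<open>All stages turn out to deviate from the Taylor polynomial by O(h^2). The quadratic
  remainder of a linearization about that polynomial is therefore O(h^4) and, with the factor h in
  front of each sum, lands in O(h^5); hence only linear expressions survive. With D_k the defect for
  the k-th power, they demand b D_1 = 0, (b c) D_1 = 0, b D_2 = 0 and b A D_1 = 0, the last for all
  four pairs of a coupling matrix and a defect. For a single right-hand side these are the classical
  conditions containing A, rearranged with the quadrature conditions. Three of the four pairs follow
  from the orders of the base methods. In the fourth, slow rows within a block interpolate linearly
  between rows of A^O, so the inner weights turn A^O c^O into a trapezoidal sum over blocks, and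
  interchanging summations produces v^O. The value 1/12 balances one half of that sum against (1/6)
  sum b c^3 = 1/24. As the inner method may be implicit, the stages are known only to solve their
  equations and to tend to the initial value; rates are gained one power of h at a time.\<close>

definition vbigo :: "nat \<Rightarrow> (real \<Rightarrow> 'a::real_normed_vector) \<Rightarrow> bool" where
  "vbigo k g \<longleftrightarrow> (\<exists>C. \<forall>\<^sub>F h in at_right 0. norm (g h) \<le> C * h ^ k)"

lemma eventually_small: "(\<forall>\<^sub>F h in at_right (0::real). 0 < h \<and> h < 1)"
  unfolding eventually_at_right_field by (rule exI[of _ 1]) auto

lemma vbigo_cong:
  assumes "vbigo k f" "\<forall>\<^sub>F h in at_right 0. g h = f h"
  shows "vbigo k g"
proof -
  obtain C where "\<forall>\<^sub>F h in at_right 0. norm (f h) \<le> C * h ^ k"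
    using assms(1) unfolding vbigo_def by blast
  with assms(2) have "\<forall>\<^sub>F h in at_right 0. norm (g h) \<le> C * h ^ k"
    by eventually_elim auto
  then show ?thesis unfolding vbigo_def by blast
qed

lemma vbigo_eq: "vbigo k f \<Longrightarrow> (\<And>h. g h = f h) \<Longrightarrow> vbigo k g"
  by presburger

lemma vbigo_bound:
  assumes "vbigo k f" "0 \<le> M" "\<forall>\<^sub>F h in at_right 0. norm (g h) \<le> M * norm (f h)"
  shows "vbigo k g"
proof -
  obtain C where "\<forall>\<^sub>F h in at_right 0. norm (f h) \<le> C * h ^ k"
    using assms(1) unfolding vbigo_def by blast
  with assms(3) have "\<forall>\<^sub>F h in at_right 0. norm (g h) \<le> (M * C) * h ^ k"
  proof eventually_elim
    case (elim h)
    show ?case using mult_left_mono[OF elim(2) assms(2)] elim(1) by (simp add: mult.assoc)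
  qed
  then show ?thesis unfolding vbigo_def by blast
qed

lemma vbigo_zero: "vbigo k (\<lambda>h. 0)"
  unfolding vbigo_def by (rule exI[of _ 0]) auto

lemma vbigo_add:
  assumes "vbigo k f" "vbigo k g"
  shows "vbigo k (\<lambda>h. f h + g h)"
proof -
  obtain C D where "\<forall>\<^sub>F h in at_right 0. norm (f h) \<le> C * h ^ k" "\<forall>\<^sub>F h in at_right 0. norm (g h) \<le> D * h ^ k"
    using assms unfolding vbigo_def by blast
  then have "\<forall>\<^sub>F h in at_right 0. norm (f h + g h) \<le> (C + D) * h ^ k"
  proof eventually_elim
    case (elim h)
    then show ?case using norm_triangle_ineq[of "f h" "g h"] by (simp add: distrib_right)
  qed
  then show ?thesis unfolding vbigo_def by blast
qed

lemma vbigo_scaleR: "vbigo k f \<Longrightarrow> vbigo k (\<lambda>h. r *\<^sub>R f h)"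
  by (erule vbigo_bound[where M = "\<bar>r\<bar>"]) auto

lemma vbigo_diff:
  assumes "vbigo k f" "vbigo k g"
  shows "vbigo k (\<lambda>h. f h - g h)"
  using vbigo_add[OF assms(1) vbigo_scaleR[OF assms(2), of "-1"]] by simp

lemma vbigo_sum:
  assumes "\<And>i. i \<in> S \<Longrightarrow> vbigo k (f i)"
  shows "vbigo k (\<lambda>h. \<Sum>i\<in>S. f i h)"
  using assms by (induction S rule: infinite_finite_induct) (auto intro: vbigo_add vbigo_zero)

lemma vbigo_power_scaleR:
  assumes "vbigo k f"
  shows "vbigo (j + k) (\<lambda>h. h ^ j *\<^sub>R f h)"
proof -
  obtain C where "\<forall>\<^sub>F h in at_right 0. norm (f h) \<le> C * h ^ k"
    using assms(1) unfolding vbigo_def by blast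
  with eventually_small have "\<forall>\<^sub>F h in at_right 0. norm (h ^ j *\<^sub>R f h) \<le> C * h ^ (j + k)"
  proof eventually_elim
    case (elim h)
    then have "h ^ j * norm (f h) \<le> h ^ j * (C * h ^ k)" by (intro mult_left_mono) auto
    then show ?case using elim by (simp add: power_add mult_ac)
  qed
  then show ?thesis unfolding vbigo_def by blast
qed

lemma vbigo_Suc_scaleR: "vbigo k f \<Longrightarrow> vbigo (Suc k) (\<lambda>h. h *\<^sub>R f h)"
  using vbigo_power_scaleR[of k f 1] by simp

lemma vbigo_mono:
  assumes "vbigo k f" "j \<le> k"
  shows "vbigo j f"
proof -
  obtain C where "\<forall>\<^sub>F h in at_right 0. norm (f h) \<le> C * h ^ k"
    using assms(1) unfolding vbigo_def by blast
  with eventually_small have "\<forall>\<^sub>F h in at_right 0. norm (f h) \<le> \<bar>C\<bar> * h ^ j"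
  proof eventually_elim
    case (elim h)
    have "C * h ^ k \<le> \<bar>C\<bar> * h ^ k" using elim by (intro mult_right_mono) auto
    also have "\<dots> \<le> \<bar>C\<bar> * h ^ j" using elim assms(2) by (intro mult_left_mono power_decreasing) auto
    finally show ?case using elim by linarith
  qed
  then show ?thesis unfolding vbigo_def by blast
qed

text \<open>Domination by a product of norms, rather than an actual product, covers both the
  quadratic remainder of a linearization and the change of a derivative under a move of its base
  point.\<close>

lemma vbigo_mult:
  assumes "vbigo j f" "vbigo k g" "0 \<le> M" "\<forall>\<^sub>F h in at_right 0. norm (r h) \<le> M * norm (f h) * norm (g h)"
  shows "vbigo (j + k) r"
proof -
  obtain C D where "\<forall>\<^sub>F h in at_right 0. norm (f h) \<le> C * h ^ j" "\<forall>\<^sub>F h in at_right 0. norm (g h) \<le> D * h ^ k"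
    using assms unfolding vbigo_def by blast
  with assms(4) have "\<forall>\<^sub>F h in at_right 0. norm (r h) \<le> (M * C * D) * h ^ (j + k)"
  proof eventually_elim
    case (elim h)
    have "norm (f h) * norm (g h) \<le> (C * h ^ j) * (D * h ^ k)"
      using elim(2,3) by (intro mult_mono) (auto intro!: order_trans[OF norm_ge_zero])
    from mult_left_mono[OF this assms(3)] show ?case
      using elim(1) by (simp add: power_add mult_ac)
  qed
  then show ?thesis unfolding vbigo_def by blast
qed

lemma vbigo_const: "vbigo 0 (\<lambda>h. v)"
  unfolding vbigo_def by (rule exI[of _ "norm v"]) auto

lemma vbigo_monom: "j \<le> k \<Longrightarrow> vbigo j (\<lambda>h. h ^ k *\<^sub>R v)"
  using vbigo_mono[OF vbigo_power_scaleR[OF vbigo_const, of k v]] by simp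

lemma vbigo_0_tendsto:
  assumes "(f \<longlongrightarrow> l) (at_right 0)"
  shows "vbigo 0 f"
proof -
  have "\<forall>\<^sub>F h in at_right 0. dist (f h) l < 1" using assms by (rule tendstoD) simp
  then have "\<forall>\<^sub>F h in at_right 0. norm (f h) \<le> (norm l + 1) * h ^ 0"
  proof eventually_elim
    case (elim h)
    then show ?case using norm_triangle_ineq2[of "f h" l] by (simp add: dist_norm)
  qed
  then show ?thesis unfolding vbigo_def by blast
qed

lemma vbigo_tendsto_0:
  assumes "vbigo (Suc k) f"
  shows "(f \<longlongrightarrow> 0) (at_right 0)"
proof -
  obtain C where C: "\<forall>\<^sub>F h in at_right 0. norm (f h) \<le> C * h ^ Suc k"
    using assms(1) unfolding vbigo_def by blast
  have "((\<lambda>h::real. C * h ^ Suc k) \<longlongrightarrow> C * 0 ^ Suc k) (at_right 0)"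
    by (intro tendsto_intros)
  then show ?thesis using C by (intro Lim_null_comparison[of f "\<lambda>h. C * h ^ Suc k"]) auto
qed

lemma vbigo_tendsto:
  assumes "vbigo (Suc k) (\<lambda>h. f h - l)"
  shows "(f \<longlongrightarrow> l) (at_right 0)"
  using vbigo_tendsto_0[OF assms] by (simp add: LIM_zero_iff)

lemma vbigo_interval:
  assumes "0 < d" "\<And>t. t \<in> {0..d} \<Longrightarrow> norm (g t) \<le> C * \<bar>t\<bar> ^ k"
  shows "vbigo k g"
proof -
  have "\<forall>\<^sub>F h in at_right 0. h < d \<and> 0 < h"
    unfolding eventually_at_right_field using assms(1) by blast
  then have "\<forall>\<^sub>F h in at_right 0. norm (g h) \<le> C * h ^ k"
  proof eventually_elim
    case (elim h)
    with assms(2)[of h] show ?case by simp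
  qed
  then show ?thesis unfolding vbigo_def by blast
qed

text \<open>Uniqueness of asymptotic expansions: the limit at 0 kills the constant coefficient, and
  dividing by h reduces \<open>n\<close> by one.\<close>

lemma vbigo_poly_coeffs_eq_0:
  fixes v :: "nat \<Rightarrow> 'a::real_normed_vector"
  assumes "vbigo n (\<lambda>h. \<Sum>j<n. h ^ j *\<^sub>R v j)" "j < n"
  shows "v j = 0"
  using assms
proof (induction n arbitrary: v j)
  case 0
  then show ?case by simp
next
  case (Suc n)
  have split: "(\<Sum>j<Suc n. h ^ j *\<^sub>R v j) = v 0 + h *\<^sub>R (\<Sum>j<n. h ^ j *\<^sub>R v (Suc j))" for h :: real
    by (simp add: sum.lessThan_Suc_shift scaleR_sum_right del: sum.lessThan_Suc)
  have "((\<lambda>h. \<Sum>j<Suc n. h ^ j *\<^sub>R v j) \<longlongrightarrow> v 0 + 0 *\<^sub>R (\<Sum>j<n. 0 ^ j *\<^sub>R v (Suc j))) (at_right (0::real))"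
    unfolding split by (intro tendsto_intros)
  moreover have "((\<lambda>h. \<Sum>j<Suc n. h ^ j *\<^sub>R v j) \<longlongrightarrow> 0) (at_right (0::real))"
    using Suc.prems(1) by (rule vbigo_tendsto_0)
  ultimately have v0: "v 0 = 0"
    using tendsto_unique[of "at_right (0::real)"] by fastforce
  obtain C where "\<forall>\<^sub>F h in at_right 0. norm (\<Sum>j<Suc n. h ^ j *\<^sub>R v j) \<le> C * h ^ Suc n"
    using Suc.prems(1) unfolding vbigo_def by blast
  with eventually_small have "\<forall>\<^sub>F h in at_right 0. norm (\<Sum>j<n. h ^ j *\<^sub>R v (Suc j)) \<le> C * h ^ n"
  proof eventually_elim
    case (elim h)
    then have "h * norm (\<Sum>j<n. h ^ j *\<^sub>R v (Suc j)) \<le> h * (C * h ^ n)"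
      unfolding split v0 by (simp add: mult_ac)
    with elim show ?case by simp
  qed
  then have "vbigo n (\<lambda>h. \<Sum>j<n. h ^ j *\<^sub>R v (Suc j))" unfolding vbigo_def by blast
  from Suc.IH[OF this] have "v (Suc i) = 0" if "i < n" for i using that by blast
  with v0 Suc.prems(2) show ?case by (cases j) auto
qed

section \<open>Taylor expansion of curves and right-hand sides\<close>

text \<open>Derivatives are taken within \<open>S\<close> because the exact solution is given only
  on an interval that starts at the initial time.\<close>

primrec smooth_curve :: "nat \<Rightarrow> real set \<Rightarrow> (real \<Rightarrow> 'a::real_normed_vector) \<Rightarrow> bool" where
  "smooth_curve 0 S g \<longleftrightarrow> continuous_on S g"
| "smooth_curve (Suc k) S g \<longleftrightarrow>
     (\<exists>g'. (\<forall>t\<in>S. (g has_vector_derivative g' t) (at t within S)) \<and> smooth_curve k S g')"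

lemma smooth_curve_continuous_on: "smooth_curve k S g \<Longrightarrow> continuous_on S g"
  by (cases k) (auto simp: continuous_on_eq_continuous_within intro: has_vector_derivative_continuous)

lemma smooth_curve_SucD: "smooth_curve (Suc k) S g \<Longrightarrow> smooth_curve k S g"
proof (induction k arbitrary: g)
  case 0
  then have "continuous_on S g" by (rule smooth_curve_continuous_on)
  then show ?case by simp
next
  case (Suc k)
  then obtain g' where "\<forall>t\<in>S. (g has_vector_derivative g' t) (at t within S)" "smooth_curve (Suc k) S g'"
    by (auto simp del: smooth_curve.simps simp: smooth_curve.simps(2)[of "Suc k"])
  with Suc.IH show ?case by auto
qed

lemma smooth_curve_const: "smooth_curve k S (\<lambda>t. v)"
  by (induction k arbitrary: v) (auto intro!: exI[of _ "\<lambda>t. 0"])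

lemma smooth_curve_id: "smooth_curve k S (\<lambda>t. t)"
  by (cases k) (auto intro!: exI[of _ "\<lambda>t. 1"] smooth_curve_const)

lemma smooth_curve_add:
  "smooth_curve k S f \<Longrightarrow> smooth_curve k S g \<Longrightarrow> smooth_curve k S (\<lambda>t. f t + g t)"
proof (induction k arbitrary: f g)
  case 0
  then show ?case by (auto intro: continuous_on_add)
next
  case (Suc k)
  then obtain f' g' where "\<forall>t\<in>S. (f has_vector_derivative f' t) (at t within S)" "smooth_curve k S f'"
      "\<forall>t\<in>S. (g has_vector_derivative g' t) (at t within S)" "smooth_curve k S g'" by auto
  with Suc.IH show ?case by (auto intro!: exI[of _ "\<lambda>t. f' t + g' t"] has_vector_derivative_add)
qed

lemma smooth_curve_sum:
  assumes "\<And>i. i \<in> T \<Longrightarrow> smooth_curve k S (f i)"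
  shows "smooth_curve k S (\<lambda>t. \<Sum>i\<in>T. f i t)"
  using assms
  by (induction T rule: infinite_finite_induct) (auto intro: smooth_curve_add smooth_curve_const)

lemma smooth_curve_bounded_linear:
  assumes "bounded_linear L"
  shows "smooth_curve k S f \<Longrightarrow> smooth_curve k S (\<lambda>t. L (f t))"
proof (induction k arbitrary: f)
  case 0
  then show ?case using assms by (auto intro: bounded_linear.continuous_on)
next
  case (Suc k)
  then obtain f' where "\<forall>t\<in>S. (f has_vector_derivative f' t) (at t within S)" "smooth_curve k S f'"
    by auto
  with Suc.IH show ?case
    by (auto intro!: exI[of _ "\<lambda>t. L (f' t)"] bounded_linear.has_vector_derivative[OF assms])
qed

lemma smooth_curve_scaleR:
  fixes r :: "real \<Rightarrow> real"
  shows "smooth_curve k S r \<Longrightarrow> smooth_curve k S g \<Longrightarrow> smooth_curve k S (\<lambda>t. r t *\<^sub>R g t)"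
proof (induction k arbitrary: r g)
  case 0
  then show ?case by (auto intro: continuous_on_scaleR)
next
  case (Suc k)
  then obtain r' g' where D: "\<forall>t\<in>S. (r has_vector_derivative r' t) (at t within S)" "smooth_curve k S r'"
      "\<forall>t\<in>S. (g has_vector_derivative g' t) (at t within S)" "smooth_curve k S g'" by auto
  have "smooth_curve k S r" "smooth_curve k S g" by (rule smooth_curve_SucD[OF Suc.prems(1)], rule smooth_curve_SucD[OF Suc.prems(2)])
  with D Suc.IH have "smooth_curve k S (\<lambda>t. r t *\<^sub>R g' t + r' t *\<^sub>R g t)"
    by (intro smooth_curve_add) auto
  with D show ?case
    by (auto intro!: exI[of _ "\<lambda>t. r t *\<^sub>R g' t + r' t *\<^sub>R g t"] has_vector_derivative_scaleR
        simp: has_real_derivative_iff_has_vector_derivative)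
qed

lemma smooth_curve_poly: "smooth_curve k S (\<lambda>t. \<Sum>j<n. t ^ j *\<^sub>R a j)"
proof -
  have "smooth_curve k S (\<lambda>t::real. t ^ j)" for j
  proof (induction j)
    case 0
    show ?case by (simp add: smooth_curve_const)
  next
    case (Suc j)
    from smooth_curve_scaleR[OF smooth_curve_id this] show ?case by simp
  qed
  then show ?thesis by (intro smooth_curve_sum smooth_curve_scaleR[OF _ smooth_curve_const])
qed

text \<open>The mean value inequality on the segment from 0 to t takes the place of integrating the
  bound. The factor 1/(k+1) that integration would give is immaterial for orders.\<close>

lemma has_vector_derivative_norm_bound:
  fixes r :: "real \<Rightarrow> 'a::real_normed_vector"
  assumes S: "convex S" "0 \<in> S" and "r 0 = 0"
    and der: "\<And>t. t \<in> S \<Longrightarrow> (r has_vector_derivative r' t) (at t within S)"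
    and bnd: "\<And>t. t \<in> S \<Longrightarrow> norm (r' t) \<le> C * \<bar>t\<bar> ^ k"
    and "t \<in> S" "0 \<le> C"
  shows "norm (r t) \<le> C * \<bar>t\<bar> ^ Suc k"
proof -
  let ?T = "closed_segment 0 t"
  have sub: "?T \<subseteq> S" using S \<open>t \<in> S\<close> by (intro closed_segment_subset)
  have "norm (r t - r 0) \<le> (C * \<bar>t\<bar> ^ k) * norm (t - 0)"
  proof (rule differentiable_bound[of ?T r "\<lambda>x h. h *\<^sub>R r' x"])
    show "(r has_derivative (\<lambda>h. h *\<^sub>R r' x)) (at x within ?T)" if "x \<in> ?T" for x
      using der[of x] that sub unfolding has_vector_derivative_def
      by (auto intro: has_derivative_subset)
    show "onorm (\<lambda>h. h *\<^sub>R r' x) \<le> C * \<bar>t\<bar> ^ k" if "x \<in> ?T" for x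
    proof (rule onorm_le)
      fix h :: real
      have "norm (r' x) \<le> C * \<bar>t\<bar> ^ k"
      proof -
        have "\<bar>x\<bar> \<le> \<bar>t\<bar>" using that by (auto simp: closed_segment_eq_real_ivl split: if_splits)
        then have "C * \<bar>x\<bar> ^ k \<le> C * \<bar>t\<bar> ^ k" using \<open>0 \<le> C\<close> by (intro mult_left_mono power_mono) auto
        with bnd[of x] that sub show ?thesis by (meson order_trans subsetD)
      qed
      from mult_right_mono[OF this, of "norm h"]
      show "norm (h *\<^sub>R r' x) \<le> C * \<bar>t\<bar> ^ k * norm h" by (simp add: mult.commute)
    qed
  qed auto
  then show ?thesis using \<open>r 0 = 0\<close> by (simp add: mult_ac)
qed

lemma has_vector_derivative_poly:
  "((\<lambda>t. v + (\<Sum>j<n. t ^ Suc j *\<^sub>R (inverse (real (Suc j)) *\<^sub>R a j))) has_vector_derivative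
     (\<Sum>j<n. t ^ j *\<^sub>R a j)) (at t within S)"
proof -
  have "((\<lambda>t. t ^ Suc j *\<^sub>R (inverse (real (Suc j)) *\<^sub>R a j)) has_vector_derivative t ^ j *\<^sub>R a j) (at t within S)" for j
  proof -
    have "((\<lambda>t::real. t ^ Suc j) has_vector_derivative (real (Suc j) * t ^ j)) (at t within S)"
      unfolding has_real_derivative_iff_has_vector_derivative[symmetric]
      using DERIV_pow[of "Suc j" t S] by simp
    from has_vector_derivative_scaleR[OF this[folded has_real_derivative_iff_has_vector_derivative] has_vector_derivative_const[of "inverse (real (Suc j)) *\<^sub>R a j"]]
    show ?thesis by (simp add: field_simps del: of_nat_Suc)
  qed
  then have "((\<lambda>t. \<Sum>j<n. t ^ Suc j *\<^sub>R (inverse (real (Suc j)) *\<^sub>R a j)) has_vector_derivative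
      (\<Sum>j<n. t ^ j *\<^sub>R a j)) (at t within S)"
    by (intro has_vector_derivative_sum)
  from has_vector_derivative_add[OF has_vector_derivative_const[of v] this] show ?thesis by simp
qed

text \<open>The expansion of the derivative is integrated term by term, which raises the order of
  the remainder by one; compactness supplies the bound at order zero. The coefficients remain
  existential, since no formula for them in terms of higher derivatives is ever used.\<close>

lemma smooth_curve_taylor:
  assumes S: "convex S" "compact S" "0 \<in> S"
  shows "smooth_curve k S g \<Longrightarrow>
    \<exists>a C. 0 \<le> C \<and> (0 < k \<longrightarrow> a 0 = g 0) \<and> (\<forall>t\<in>S. norm (g t - (\<Sum>j<k. t ^ j *\<^sub>R a j)) \<le> C * \<bar>t\<bar> ^ k)"
proof (induction k arbitrary: g)
  case 0
  then have "compact (g ` S)" using S by (auto intro: compact_continuous_image)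
  then obtain C where "\<forall>x\<in>g ` S. norm x \<le> C" by (meson bounded_iff compact_imp_bounded)
  then show ?case using S by (auto intro!: exI[of _ "\<bar>C\<bar>"])
next
  case (Suc k)
  from Suc.prems obtain g' where g': "\<And>t. t \<in> S \<Longrightarrow> (g has_vector_derivative g' t) (at t within S)" "smooth_curve k S g'"
    unfolding smooth_curve.simps by blast
  from Suc.IH[OF g'(2)] obtain a C where aC: "0 \<le> C"
      "\<And>t. t\<in>S \<Longrightarrow> norm (g' t - (\<Sum>j<k. t ^ j *\<^sub>R a j)) \<le> C * \<bar>t\<bar> ^ k" by blast
  define b where "b j = (case j of 0 \<Rightarrow> g 0 | Suc i \<Rightarrow> inverse (real (Suc i)) *\<^sub>R a i)" for j
  let ?p = "\<lambda>t. g 0 + (\<Sum>j<k. t ^ Suc j *\<^sub>R (inverse (real (Suc j)) *\<^sub>R a j))"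
  have p: "(\<Sum>j<Suc k. t ^ j *\<^sub>R b j) = ?p t" for t
    by (simp add: sum.lessThan_Suc_shift b_def del: sum.lessThan_Suc)
  have "norm (g t - ?p t) \<le> C * \<bar>t\<bar> ^ Suc k" if "t \<in> S" for t
  proof (rule has_vector_derivative_norm_bound[where r = "\<lambda>t. g t - ?p t" and r' = "\<lambda>t. g' t - (\<Sum>j<k. t ^ j *\<^sub>R a j)", OF S(1,3) _ _ aC(2) that aC(1)])
    show "((\<lambda>t. g t - ?p t) has_vector_derivative (g' t - (\<Sum>j<k. t ^ j *\<^sub>R a j))) (at t within S)" if "t \<in> S" for t
      using g'(1)[OF that] has_vector_derivative_poly by (rule has_vector_derivative_diff)
  qed auto
  then have "\<forall>t\<in>S. norm (g t - (\<Sum>j<Suc k. t ^ j *\<^sub>R b j)) \<le> C * \<bar>t\<bar> ^ Suc k"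
    unfolding p by blast
  moreover have "b 0 = g 0" by (simp add: b_def)
  ultimately show ?case using aC(1) by blast
qed

section \<open>Calculus of right-hand sides of class C^m: composition, Lipschitz bounds,
  linearization\<close>

lemma C_diff_continuous_on:
  assumes "C_diff m f"
  shows "continuous_on S f"
proof (cases m)
  case 0
  with assms show ?thesis by (auto intro: continuous_on_subset)
next
  case (Suc k)
  with assms have "f differentiable (at x)" for x by simp
  then show ?thesis
    using differentiable_imp_continuous_within continuous_at_imp_continuous_on by blast
qed

lemma C_diff_SucD: "C_diff (Suc m) f \<Longrightarrow> C_diff m f"
proof (induction m arbitrary: f)
  case 0
  then have "continuous_on UNIV f" by (rule C_diff_continuous_on)
  then show ?case by simp
next
  case (Suc m)
  from Suc.prems have "\<forall>v. C_diff (Suc m) (\<lambda>x. frechet_derivative f (at x) v)" "\<forall>x. f differentiable (at x)"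
    unfolding C_diff.simps(2)[of "Suc m"] by blast+
  with Suc.IH have "\<forall>v. C_diff m (\<lambda>x. frechet_derivative f (at x) v)" by blast
  with \<open>\<forall>x. f differentiable (at x)\<close> show ?case by simp
qed

lemma C_diff_mono: "m \<le> n \<Longrightarrow> C_diff n f \<Longrightarrow> C_diff m f"
proof (induction rule: dec_induct)
  case (step n)
  from step.IH[OF C_diff_SucD[OF step.prems]] show ?case .
qed

lemma C_diff_has_derivative:
  "C_diff (Suc m) f \<Longrightarrow> (f has_derivative frechet_derivative f (at x)) (at x within S)"
  by (auto simp: frechet_derivative_works intro: has_derivative_at_withinI)

text \<open>\<open>C_diff\<close> controls the derivative in one fixed direction at a time. Writing
  it through finitely many basis directions yields the bounds uniform in \<open>v\<close> that the
  later estimates require.\<close>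

lemma frechet_derivative_expand:
  fixes f :: "real^'n \<Rightarrow> real^'n"
  assumes "C_diff (Suc m) f"
  shows "frechet_derivative f (at x) v = (\<Sum>e\<in>Basis. (v \<bullet> e) *\<^sub>R frechet_derivative f (at x) e)"
proof -
  have "linear (frechet_derivative f (at x))"
    using C_diff_has_derivative[OF assms, of x UNIV] by (simp add: has_derivative_linear)
  then have "frechet_derivative f (at x) (\<Sum>e\<in>Basis. (v \<bullet> e) *\<^sub>R e) = (\<Sum>e\<in>Basis. (v \<bullet> e) *\<^sub>R frechet_derivative f (at x) e)"
    by (simp add: linear_sum linear_scale)
  then show ?thesis by (simp add: euclidean_representation)
qed

text \<open>The chain rule in coordinates keeps the derivative within sums of products of smooth
  curves: the induction hypothesis applies to each directional derivative of \<open>f\<close> along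
  the same curve.\<close>

lemma C_diff_smooth_curve:
  fixes y :: "real \<Rightarrow> real^'n"
  shows "C_diff k f \<Longrightarrow> smooth_curve k S y \<Longrightarrow> smooth_curve k S (\<lambda>t. f (y t))"
proof (induction k arbitrary: f y)
  case 0
  then show ?case by (auto intro: continuous_on_compose2[of UNIV f])
next
  case (Suc k)
  then obtain y' where y': "\<forall>t\<in>S. (y has_vector_derivative y' t) (at t within S)" "smooth_curve k S y'" by auto
  let ?D = "\<lambda>t. \<Sum>e\<in>Basis. (y' t \<bullet> e) *\<^sub>R frechet_derivative f (at (y t)) e"
  have "smooth_curve k S ?D"
    using Suc.IH[of "\<lambda>x. frechet_derivative f (at x) e" y for e] Suc.prems smooth_curve_SucD[OF Suc.prems(2)] y'(2)
    by (intro smooth_curve_sum smooth_curve_scaleR smooth_curve_bounded_linear[OF bounded_linear_inner_left]) auto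
  moreover have "((\<lambda>t. f (y t)) has_vector_derivative ?D t) (at t within S)" if "t \<in> S" for t
  proof -
    have "(y has_derivative (\<lambda>h. h *\<^sub>R y' t)) (at t within S)"
      using y'(1) that by (simp add: has_vector_derivative_def)
    from has_derivative_compose[OF this C_diff_has_derivative[OF Suc.prems(1), of _ UNIV]]
    have "((\<lambda>t. f (y t)) has_derivative (\<lambda>h. frechet_derivative f (at (y t)) (h *\<^sub>R y' t))) (at t within S)" .
    moreover have "frechet_derivative f (at (y t)) (h *\<^sub>R y' t) = h *\<^sub>R frechet_derivative f (at (y t)) (y' t)" for h
      using C_diff_has_derivative[OF Suc.prems(1), of "y t" UNIV] by (simp add: has_derivative_linear linear_scale)
    ultimately show ?thesis
      unfolding has_vector_derivative_def frechet_derivative_expand[OF Suc.prems(1), symmetric] by simp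
  qed
  ultimately show ?case unfolding smooth_curve.simps(2) by (intro exI[of _ ?D] conjI ballI)
qed

lemma C_diff_derivative_bound:
  fixes f :: "real^'n \<Rightarrow> real^'n"
  assumes "C_diff (Suc m) f" "compact S"
  shows "\<exists>C\<ge>0. \<forall>x\<in>S. \<forall>v. norm (frechet_derivative f (at x) v) \<le> C * norm v"
proof -
  have "\<exists>B\<ge>0. \<forall>x\<in>S. norm (frechet_derivative f (at x) e) \<le> B" for e
  proof -
    have "compact ((\<lambda>x. frechet_derivative f (at x) e) ` S)"
      using assms by (intro compact_continuous_image) (auto intro: C_diff_continuous_on)
    then obtain B where "\<forall>x\<in>S. norm (frechet_derivative f (at x) e) \<le> B"
      by (metis (no_types, lifting) bounded_iff compact_imp_bounded image_eqI)
    then show ?thesis by (intro exI[of _ "\<bar>B\<bar>"]) fastforce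
  qed
  then obtain B where B: "\<And>e. B e \<ge> 0" "\<And>e x. x \<in> S \<Longrightarrow> norm (frechet_derivative f (at x) e) \<le> B e"
    by metis
  have "norm (frechet_derivative f (at x) v) \<le> (\<Sum>e\<in>Basis. B e) * norm v" if "x \<in> S" for x v
    unfolding frechet_derivative_expand[OF assms(1), of x v] sum_distrib_right
  proof (rule sum_norm_le)
    fix e :: "real^'n" assume "e \<in> Basis"
    then have "\<bar>v \<bullet> e\<bar> * norm (frechet_derivative f (at x) e) \<le> norm v * B e"
      using B that by (intro mult_mono Basis_le_norm) auto
    then show "norm ((v \<bullet> e) *\<^sub>R frechet_derivative f (at x) e) \<le> B e * norm v"
      by (simp add: mult.commute)
  qed
  then show ?thesis using B(1) by (intro exI[of _ "\<Sum>e\<in>Basis. B e"]) (auto intro: sum_nonneg)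
qed

lemma C_diff_Lipschitz:
  fixes f :: "real^'n \<Rightarrow> real^'n"
  assumes "C_diff (Suc m) f" "compact S" "convex S"
  shows "\<exists>C\<ge>0. \<forall>x\<in>S. \<forall>y\<in>S. norm (f x - f y) \<le> C * norm (x - y)"
proof -
  obtain C where C: "C \<ge> 0" "\<And>x v. x\<in>S \<Longrightarrow> norm (frechet_derivative f (at x) v) \<le> C * norm v"
    using C_diff_derivative_bound[OF assms(1,2)] by blast
  have "norm (f x - f y) \<le> C * norm (x - y)" if "x \<in> S" "y \<in> S" for x y
    by (rule differentiable_bound[OF assms(3) C_diff_has_derivative[OF assms(1)] _ that])
       (auto intro: onorm_le C)
  with C(1) show ?thesis by blast
qed

lemma C_diff_derivative_Lipschitz:
  fixes f :: "real^'n \<Rightarrow> real^'n"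
  assumes "C_diff (Suc (Suc m)) f" "compact S" "convex S"
  shows "\<exists>C\<ge>0. \<forall>x\<in>S. \<forall>y\<in>S. \<forall>v.
    norm (frechet_derivative f (at x) v - frechet_derivative f (at y) v) \<le> C * norm (x - y) * norm v"
proof -
  have "C_diff (Suc m) (\<lambda>x. frechet_derivative f (at x) e)" for e
    using assms(1) unfolding C_diff.simps(2)[of "Suc m"] by blast
  from C_diff_Lipschitz[OF this assms(2,3)]
  obtain B where B: "\<And>e. B e \<ge> 0" "\<And>e x y. x \<in> S \<Longrightarrow> y \<in> S \<Longrightarrow>
      norm (frechet_derivative f (at x) e - frechet_derivative f (at y) e) \<le> B e * norm (x - y)"
    by metis
  have "norm (frechet_derivative f (at x) v - frechet_derivative f (at y) v) \<le> (\<Sum>e\<in>Basis. B e) * norm (x - y) * norm v"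
    if "x \<in> S" "y \<in> S" for x y v
    unfolding frechet_derivative_expand[OF assms(1), of x v] frechet_derivative_expand[OF assms(1), of y v]
      sum_distrib_right sum_subtractf[symmetric] scaleR_diff_right[symmetric]
  proof (rule sum_norm_le)
    fix e :: "real^'n" assume "e \<in> Basis"
    then have "\<bar>v \<bullet> e\<bar> * norm (frechet_derivative f (at x) e - frechet_derivative f (at y) e)
        \<le> norm v * (B e * norm (x - y))"
      using B(2)[OF that] by (intro mult_mono Basis_le_norm) auto
    then show "norm ((v \<bullet> e) *\<^sub>R (frechet_derivative f (at x) e - frechet_derivative f (at y) e)) \<le> B e * norm (x - y) * norm v"
      by (simp add: mult_ac)
  qed
  then show ?thesis using B(1) by (intro exI[of _ "\<Sum>e\<in>Basis. B e"]) (auto intro: sum_nonneg)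
qed

text \<open>Mean value inequality for \<open>f\<close> minus its linear part at \<open>x\<close>: on
  the segment the derivative of this difference is the change of the derivative of \<open>f\<close>,
  which is at most a constant times the length of the segment.\<close>

lemma C_diff_linearization:
  fixes f :: "real^'n \<Rightarrow> real^'n"
  assumes "C_diff (Suc (Suc m)) f" "compact S" "convex S"
  shows "\<exists>C\<ge>0. \<forall>x\<in>S. \<forall>y\<in>S.
    norm (f y - f x - frechet_derivative f (at x) (y - x)) \<le> C * norm (y - x) ^ 2"
proof -
  obtain C where C: "C \<ge> 0" "\<And>x y v. x \<in> S \<Longrightarrow> y \<in> S \<Longrightarrow>
    norm (frechet_derivative f (at x) v - frechet_derivative f (at y) v) \<le> C * norm (x - y) * norm v"
    using C_diff_derivative_Lipschitz[OF assms] by blast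
  have "norm (f y - f x - frechet_derivative f (at x) (y - x)) \<le> C * norm (y - x) ^ 2"
    if xy: "x \<in> S" "y \<in> S" for x y
  proof -
    let ?T = "closed_segment x y"
    have sub: "?T \<subseteq> S" using xy assms(3) by (simp add: closed_segment_subset)
    let ?g = "\<lambda>z. f z - frechet_derivative f (at x) z"
    have bl: "bounded_linear (frechet_derivative f (at x))"
      using C_diff_has_derivative[OF assms(1), of x UNIV] by (rule has_derivative_bounded_linear)
    have "norm (?g y - ?g x) \<le> (C * norm (y - x)) * norm (y - x)"
    proof (rule differentiable_bound[of ?T])
      show "(?g has_derivative (\<lambda>v. frechet_derivative f (at z) v - frechet_derivative f (at x) v)) (at z within ?T)" for z
        by (intro has_derivative_diff C_diff_has_derivative[OF assms(1)] bounded_linear_imp_has_derivative bl)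
      show "onorm (\<lambda>v. frechet_derivative f (at z) v - frechet_derivative f (at x) v) \<le> C * norm (y - x)" if z: "z \<in> ?T" for z
      proof (rule onorm_le)
        fix v :: "real^'n"
        have "norm (z - x) \<le> norm (y - x)" using segment_bound1[OF z] by (simp add: norm_minus_commute)
        then have "C * norm (z - x) * norm v \<le> C * norm (y - x) * norm v"
          using C(1) by (intro mult_right_mono mult_left_mono) auto
        moreover have "z \<in> S" using z sub by auto
        ultimately show "norm (frechet_derivative f (at z) v - frechet_derivative f (at x) v) \<le> C * norm (y - x) * norm v"
          using C(2)[OF \<open>z \<in> S\<close> xy(1), of v] by linarith
      qed
    qed auto
    moreover have "f y - f x - frechet_derivative f (at x) (y - x) = ?g y - ?g x"
      using bl by (simp add: bounded_linear.linear linear_diff)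
    ultimately show ?thesis by (simp only: power2_eq_square mult.assoc)
  qed
  with C(1) show ?thesis by blast
qed

text \<open>One expansion in t serves all abscissae \<open>s\<close> through t = s h, so the
  coefficients are chosen before \<open>s\<close>. The interval is symmetric because
  \<open>s\<close> may be negative, and s h enters it once h is small, however large
  \<open>s\<close> is.\<close>

lemma C_diff_poly_expansion:
  fixes f :: "real^'n \<Rightarrow> real^'n"
  assumes "C_diff k f"
  shows "\<exists>\<phi>. \<forall>s. vbigo k (\<lambda>h. f (\<Sum>j<n. (s * h) ^ j *\<^sub>R a j) - (\<Sum>j<k. h ^ j *\<^sub>R (s ^ j *\<^sub>R \<phi> j)))"
proof -
  let ?g = "\<lambda>t. f (\<Sum>j<n. t ^ j *\<^sub>R a j)"
  have "smooth_curve k {-1..1} ?g"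
    by (rule C_diff_smooth_curve[OF assms smooth_curve_poly])
  then have "\<exists>\<phi> C. 0 \<le> C \<and> (0 < k \<longrightarrow> \<phi> 0 = ?g 0) \<and>
      (\<forall>t\<in>{-1..1}. norm (?g t - (\<Sum>j<k. t ^ j *\<^sub>R \<phi> j)) \<le> C * \<bar>t\<bar> ^ k)"
    by (intro smooth_curve_taylor) simp_all
  then obtain \<phi> C where
    C: "\<And>t. t \<in> {-1..1} \<Longrightarrow> norm (?g t - (\<Sum>j<k. t ^ j *\<^sub>R \<phi> j)) \<le> C * \<bar>t\<bar> ^ k"
    by (elim exE conjE) (rule that, erule bspec)
  have "vbigo k (\<lambda>h. f (\<Sum>j<n. (s * h) ^ j *\<^sub>R a j) - (\<Sum>j<k. h ^ j *\<^sub>R (s ^ j *\<^sub>R \<phi> j)))" for s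
    unfolding vbigo_def
  proof (rule exI[of _ "C * \<bar>s\<bar> ^ k"])
    have "((\<lambda>h. s * h) \<longlongrightarrow> s * 0) (at_right 0)" by (intro tendsto_intros)
    then have "\<forall>\<^sub>F h in at_right 0. dist (s * h) (s * 0) < 1" by (rule tendstoD) simp
    with eventually_small show "\<forall>\<^sub>F h in at_right 0. norm (f (\<Sum>j<n. (s * h) ^ j *\<^sub>R a j) - (\<Sum>j<k. h ^ j *\<^sub>R (s ^ j *\<^sub>R \<phi> j))) \<le> C * \<bar>s\<bar> ^ k * h ^ k"
    proof eventually_elim
      case (elim h)
      then have "s * h \<in> {-1..1}" by (auto simp: dist_real_def)
      from C[OF this] show ?case using elim by (simp add: power_mult_distrib abs_mult mult_ac)
    qed
  qed
  then show ?thesis by blast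
qed

text \<open>Convergence of both arguments to \<open>y0\<close> places them eventually in the unit
  ball about \<open>y0\<close>; a local Lipschitz constant on this compact convex set is all that is
  available for a smooth \<open>f\<close>.\<close>

lemma vbigo_compose_diff:
  fixes f :: "real^'n \<Rightarrow> real^'n"
  assumes "C_diff (Suc m) f" "(p \<longlongrightarrow> y0) (at_right 0)" "(q \<longlongrightarrow> y0) (at_right 0)"
    "vbigo k (\<lambda>h. q h - p h)"
  shows "vbigo k (\<lambda>h. f (q h) - f (p h))"
proof -
  obtain C where C: "C \<ge> 0" "\<And>x y. x \<in> cball y0 1 \<Longrightarrow> y \<in> cball y0 1 \<Longrightarrow> norm (f x - f y) \<le> C * norm (x - y)"
    using C_diff_Lipschitz[OF assms(1) compact_cball[of y0 1] convex_cball] by blast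
  from tendstoD[OF assms(2) zero_less_one] tendstoD[OF assms(3) zero_less_one]
  have "\<forall>\<^sub>F h in at_right 0. norm (f (q h) - f (p h)) \<le> C * norm (q h - p h)"
    by eventually_elim (rule C(2); simp add: dist_commute)
  then show ?thesis by (rule vbigo_bound[OF assms(4) C(1)])
qed

lemma vbigo_compose_linearization:
  fixes f :: "real^'n \<Rightarrow> real^'n"
  assumes "C_diff (Suc (Suc m)) f" "(p \<longlongrightarrow> y0) (at_right 0)" "(q \<longlongrightarrow> y0) (at_right 0)"
    "vbigo k (\<lambda>h. q h - p h)"
  shows "vbigo (k + k) (\<lambda>h. f (q h) - f (p h) - frechet_derivative f (at (p h)) (q h - p h))"
proof -
  obtain C where C: "C \<ge> 0" "\<And>x y. x \<in> cball y0 1 \<Longrightarrow> y \<in> cball y0 1 \<Longrightarrow>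
      norm (f y - f x - frechet_derivative f (at x) (y - x)) \<le> C * norm (y - x) ^ 2"
    using C_diff_linearization[OF assms(1) compact_cball[of y0 1] convex_cball] by blast
  from tendstoD[OF assms(2) zero_less_one] tendstoD[OF assms(3) zero_less_one]
  have "\<forall>\<^sub>F h in at_right 0. norm (f (q h) - f (p h) - frechet_derivative f (at (p h)) (q h - p h))
      \<le> C * norm (q h - p h) * norm (q h - p h)"
    unfolding mult.assoc power2_eq_square[symmetric]
    by eventually_elim (rule C(2); simp add: dist_commute)
  then show ?thesis by (rule vbigo_mult[OF assms(4) assms(4) C(1)])
qed

lemma vbigo_derivative:
  fixes f :: "real^'n \<Rightarrow> real^'n"
  assumes "C_diff (Suc m) f" "(p \<longlongrightarrow> y0) (at_right 0)" "vbigo k d"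
  shows "vbigo k (\<lambda>h. frechet_derivative f (at (p h)) (d h))"
proof -
  obtain C where C: "C \<ge> 0" "\<And>x v. x \<in> cball y0 1 \<Longrightarrow> norm (frechet_derivative f (at x) v) \<le> C * norm v"
    using C_diff_derivative_bound[OF assms(1) compact_cball[of y0 1]] by blast
  from tendstoD[OF assms(2) zero_less_one]
  have "\<forall>\<^sub>F h in at_right 0. norm (frechet_derivative f (at (p h)) (d h)) \<le> C * norm (d h)"
    by eventually_elim (rule C(2); simp add: dist_commute)
  then show ?thesis by (rule vbigo_bound[OF assms(3) C(1)])
qed

text \<open>Freezing the derivative at \<open>y0\<close> gains the order of the distance between the
  base points on top of the order of the argument.\<close>

lemma vbigo_derivative_diff:
  fixes f :: "real^'n \<Rightarrow> real^'n"
  assumes "C_diff (Suc (Suc m)) f" "vbigo (Suc j) (\<lambda>h. p h - y0)" "vbigo k d"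
  shows "vbigo (Suc j + k) (\<lambda>h. frechet_derivative f (at (p h)) (d h) - frechet_derivative f (at y0) (d h))"
proof -
  obtain C where C: "C \<ge> 0" "\<And>x y v. x \<in> cball y0 1 \<Longrightarrow> y \<in> cball y0 1 \<Longrightarrow>
      norm (frechet_derivative f (at x) v - frechet_derivative f (at y) v) \<le> C * norm (x - y) * norm v"
    using C_diff_derivative_Lipschitz[OF assms(1) compact_cball[of y0 1] convex_cball] by blast
  from tendstoD[OF vbigo_tendsto[OF assms(2)] zero_less_one]
  have "\<forall>\<^sub>F h in at_right 0. norm (frechet_derivative f (at (p h)) (d h) - frechet_derivative f (at y0) (d h)) \<le> C * norm (p h - y0) * norm (d h)"
    by eventually_elim (rule C(2); simp add: dist_commute)
  then show ?thesis by (rule vbigo_mult[OF assms(2,3) C(1)])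
qed

text \<open>The expansions of the single parts are kept apart because different coefficient matrices
  will act on them; the differential equation ties only their sum to the Taylor coefficients of the
  solution. They are taken along the polynomial and hence exist for every real abscissa.\<close>

lemma solution_expansion:
  fixes u :: "'q \<Rightarrow> real^'n \<Rightarrow> real^'n"
  assumes u: "\<And>q. q \<in> Q \<Longrightarrow> C_diff 4 (u q)" and d: "0 < d"
    and Y: "\<And>t. t \<in> {0..d} \<Longrightarrow> (Y has_vector_derivative (\<Sum>q\<in>Q. u q (Y t))) (at t within {0..d})"
  shows "\<exists>a \<phi>. a 0 = Y 0 \<and> (\<forall>k<4. a (Suc k) = inverse (real (Suc k)) *\<^sub>R (\<Sum>q\<in>Q. \<phi> q k)) \<and>
    vbigo 5 (\<lambda>h. Y h - (\<Sum>j<5. h ^ j *\<^sub>R a j)) \<and>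
    (\<forall>q\<in>Q. \<forall>s. vbigo 4 (\<lambda>h. u q (\<Sum>j<5. (s * h) ^ j *\<^sub>R a j) - (\<Sum>k<4. h ^ k *\<^sub>R (s ^ k *\<^sub>R \<phi> q k))))"
proof -
  let ?S = "{0..d}"
  have 0: "0 \<in> ?S" using d by simp
  \<comment> \<open>Bootstrapping: if \<open>Y\<close> has k derivatives, then so has the right-hand
    side along \<open>Y\<close>, that is, the derivative of \<open>Y\<close>.\<close>
  have smooth_Y: "k \<le> 4 \<Longrightarrow> smooth_curve k ?S Y" for k
  proof (induction k)
    case 0
    show ?case unfolding smooth_curve.simps continuous_on_eq_continuous_within
      using has_vector_derivative_continuous[OF Y] by blast
  next
    case (Suc k)
    then have Yk: "smooth_curve k ?S Y" by simp
    have uk: "C_diff k (u q)" if "q \<in> Q" for q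
      by (rule C_diff_mono[OF _ u[OF that]]) (use Suc.prems in simp)
    have "smooth_curve k ?S (\<lambda>t. \<Sum>q\<in>Q. u q (Y t))"
      by (intro smooth_curve_sum C_diff_smooth_curve[OF uk Yk])
    then show ?case unfolding smooth_curve.simps(2) using Y
      by (intro exI[of _ "\<lambda>t. \<Sum>q\<in>Q. u q (Y t)"] conjI ballI)
  qed
  have "smooth_curve 4 ?S (\<lambda>t. \<Sum>q\<in>Q. u q (Y t))"
    by (intro smooth_curve_sum C_diff_smooth_curve[OF u smooth_Y]) simp_all
  then have "\<exists>a C. 0 \<le> C \<and> (0 < (4::nat) \<longrightarrow> a 0 = (\<Sum>q\<in>Q. u q (Y 0))) \<and>
      (\<forall>t\<in>?S. norm ((\<Sum>q\<in>Q. u q (Y t)) - (\<Sum>j<4. t ^ j *\<^sub>R a j)) \<le> C * \<bar>t\<bar> ^ 4)"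
    by (rule smooth_curve_taylor[OF convex_closed_interval compact_Icc 0])
  then obtain a' C where C: "0 \<le> C"
    and a': "\<And>t. t \<in> ?S \<Longrightarrow> norm ((\<Sum>q\<in>Q. u q (Y t)) - (\<Sum>j<4. t ^ j *\<^sub>R a' j)) \<le> C * \<bar>t\<bar> ^ 4"
    by blast
  define a where "a j = (case j of 0 \<Rightarrow> Y 0 | Suc k \<Rightarrow> inverse (real (Suc k)) *\<^sub>R a' k)" for j
  define P where "P t = (\<Sum>j<5. t ^ j *\<^sub>R a j)" for t
  have P: "P t = Y 0 + (\<Sum>k<4. t ^ Suc k *\<^sub>R (inverse (real (Suc k)) *\<^sub>R a' k))" for t
  proof -
    have "P t = (\<Sum>j<Suc 4. t ^ j *\<^sub>R a j)" by (simp add: P_def)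
    then show ?thesis unfolding sum.lessThan_Suc_shift by (simp add: a_def)
  qed
  have "norm (Y t - P t) \<le> C * \<bar>t\<bar> ^ Suc 4" if "t \<in> ?S" for t
  proof (rule has_vector_derivative_norm_bound[where r = "\<lambda>t. Y t - P t"
        and r' = "\<lambda>t. (\<Sum>q\<in>Q. u q (Y t)) - (\<Sum>j<4. t ^ j *\<^sub>R a' j)", OF convex_closed_interval 0 _ _ a' that C])
    show "Y 0 - P 0 = 0" by (simp add: P)
    show "((\<lambda>t. Y t - P t) has_vector_derivative (\<Sum>q\<in>Q. u q (Y t)) - (\<Sum>j<4. t ^ j *\<^sub>R a' j)) (at t within ?S)"
      if "t \<in> ?S" for t
      unfolding P by (rule has_vector_derivative_diff[OF Y[OF that] has_vector_derivative_poly])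
  qed
  from vbigo_interval[OF d this] have YP: "vbigo 5 (\<lambda>h. Y h - P h)" by simp
  have "\<forall>q. \<exists>\<phi>. q \<in> Q \<longrightarrow> (\<forall>s. vbigo 4 (\<lambda>h. u q (P (s * h)) - (\<Sum>k<4. h ^ k *\<^sub>R (s ^ k *\<^sub>R \<phi> k))))"
    unfolding P_def using C_diff_poly_expansion[OF u] by meson
  from choice[OF this] obtain \<phi> where
    \<phi>: "\<And>q s. q \<in> Q \<Longrightarrow> vbigo 4 (\<lambda>h. u q (P (s * h)) - (\<Sum>k<4. h ^ k *\<^sub>R (s ^ k *\<^sub>R \<phi> q k)))"
    by blast
  have Y_tendsto: "(Y \<longlongrightarrow> Y 0) (at_right 0)"
  proof -
    have "(Y \<longlongrightarrow> Y 0) (at 0 within ?S)"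
      using has_vector_derivative_continuous[OF Y[OF 0]] by (simp add: continuous_within)
    then show ?thesis using at_within_Icc_at_right[OF d] by simp
  qed
  have P_tendsto: "(P \<longlongrightarrow> Y 0) (at_right 0)"
    using tendsto_diff[OF Y_tendsto vbigo_tendsto_0[of 4 "\<lambda>h. Y h - P h"]] YP by simp
  \<comment> \<open>The right-hand side has two expansions, one obtained directly along
    \<open>Y\<close> and one through \<open>P\<close>. They agree to order four because Y - P =
    O(h^5), so uniqueness equates the coefficients.\<close>
  have coeffs: "a' k = (\<Sum>q\<in>Q. \<phi> q k)" if "k < 4" for k
  proof -
    have 1: "vbigo 4 (\<lambda>h. (\<Sum>q\<in>Q. u q (Y h)) - (\<Sum>j<4. h ^ j *\<^sub>R a' j))"
      by (rule vbigo_interval[OF d a'])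
    have "vbigo 4 (\<lambda>h. u q (Y h) - u q (P h))" if "q \<in> Q" for q
    proof -
      have "C_diff (Suc 0) (u q)" by (rule C_diff_mono[OF _ u[OF that]]) simp
      from vbigo_compose_diff[OF this P_tendsto Y_tendsto YP] show ?thesis by (rule vbigo_mono) simp
    qed
    then have 2: "vbigo 4 (\<lambda>h. \<Sum>q\<in>Q. u q (Y h) - u q (P h))" by (intro vbigo_sum)
    have 3: "vbigo 4 (\<lambda>h. \<Sum>q\<in>Q. u q (P h) - (\<Sum>k<4. h ^ k *\<^sub>R \<phi> q k))"
      using \<phi>[of _ 1] by (intro vbigo_sum) simp
    have "vbigo 4 (\<lambda>h. \<Sum>k<4. h ^ k *\<^sub>R (a' k - (\<Sum>q\<in>Q. \<phi> q k)))"
    proof (rule vbigo_eq[OF vbigo_diff[OF vbigo_add[OF 2 3] 1]])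
      fix h :: real
      have "(\<Sum>q\<in>Q. \<Sum>k<4. h ^ k *\<^sub>R \<phi> q k) = (\<Sum>k<4. h ^ k *\<^sub>R (\<Sum>q\<in>Q. \<phi> q k))"
        unfolding scaleR_sum_right by (rule sum.swap)
      then show "(\<Sum>k<4. h ^ k *\<^sub>R (a' k - (\<Sum>q\<in>Q. \<phi> q k))) = (\<Sum>q\<in>Q. u q (Y h) - u q (P h)) +
         (\<Sum>q\<in>Q. u q (P h) - (\<Sum>k<4. h ^ k *\<^sub>R \<phi> q k)) - ((\<Sum>q\<in>Q. u q (Y h)) - (\<Sum>j<4. h ^ j *\<^sub>R a' j))"
        by (simp only: sum_subtractf scaleR_diff_right) simp
    qed
    from vbigo_poly_coeffs_eq_0[OF this that] show ?thesis by simp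
  qed
  have "a 0 = Y 0" by (simp add: a_def)
  moreover have "\<forall>k<4. a (Suc k) = inverse (real (Suc k)) *\<^sub>R (\<Sum>q\<in>Q. \<phi> q k)"
    using coeffs by (simp add: a_def)
  ultimately show ?thesis using YP \<phi> unfolding P_def
    by (intro exI[of _ a] exI[of _ \<phi>] conjI ballI allI) blast+
qed

section \<open>Solvability of the stage equations\<close>

text \<open>Picard iteration from the constant family \<open>y0\<close>, with the uniform bound
  \<epsilon> in the role of a maximum norm over \<open>I\<close>. The condition on h K gives
  contraction by 1/2, and the first increment is at most h M. The iterates thus move by at most the
  geometric sum 2 h M \<le> 1 and stay in the balls on which the Lipschitz bound is assumed.\<close>

lemma stage_equations_solvable:
  fixes \<Psi> :: "('i \<Rightarrow> 'a::banach) \<Rightarrow> 'i \<Rightarrow> 'a"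
  assumes Lip: "\<And>x y j \<epsilon>. j \<in> I \<Longrightarrow> (\<And>m. m \<in> I \<Longrightarrow> norm (x m - y0) \<le> 1) \<Longrightarrow>
      (\<And>m. m \<in> I \<Longrightarrow> norm (y m - y0) \<le> 1) \<Longrightarrow> (\<And>m. m \<in> I \<Longrightarrow> norm (x m - y m) \<le> \<epsilon>) \<Longrightarrow>
      norm (\<Psi> x j - \<Psi> y j) \<le> K * \<epsilon>"
    and M: "\<And>j. j \<in> I \<Longrightarrow> norm (\<Psi> (\<lambda>_. y0) j) \<le> M" "0 \<le> M"
    and h: "0 \<le> h" "h * K \<le> 1 / 2" "h * M \<le> 1 / 2"
  shows "\<exists>z. \<forall>j\<in>I. z j = y0 + h *\<^sub>R \<Psi> z j \<and> norm (z j - y0) \<le> 2 * h * M"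
proof -
  define x where "x n = ((\<lambda>x j. y0 + h *\<^sub>R \<Psi> x j) ^^ n) (\<lambda>_. y0)" for n
  have x0: "x 0 = (\<lambda>_. y0)" and xS: "x (Suc n) = (\<lambda>j. y0 + h *\<^sub>R \<Psi> (x n) j)" for n
    by (simp_all add: x_def)
  define B where "B = h * M"
  have B: "0 \<le> B" "2 * B \<le> 1" using h M(2) by (auto simp: B_def)
  have contr: "norm (h *\<^sub>R (\<Psi> v j - \<Psi> w j)) \<le> \<epsilon> / 2"
    if "j \<in> I" "\<And>m. m \<in> I \<Longrightarrow> norm (v m - y0) \<le> 1" "\<And>m. m \<in> I \<Longrightarrow> norm (w m - y0) \<le> 1"
      "\<And>m. m \<in> I \<Longrightarrow> norm (v m - w m) \<le> \<epsilon>" "0 \<le> \<epsilon>" for v w j \<epsilon>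
  proof -
    have "h * norm (\<Psi> v j - \<Psi> w j) \<le> h * (K * \<epsilon>)" using Lip[OF that(1-4)] h(1) by (intro mult_left_mono)
    also have "\<dots> \<le> (1/2) * \<epsilon>" using mult_right_mono[OF h(2) that(5)] by (simp add: mult.assoc)
    finally show ?thesis using h(1) by simp
  qed
  \<comment> \<open>The two bounds must be proved together: contraction is available only inside the
    unit balls, and staying inside comes from summing the increments B, B/2, B/4 and so on.\<close>
  have step: "(\<forall>j\<in>I. norm (x (Suc n) j - x n j) \<le> B * (1/2) ^ n) \<and> (\<forall>j\<in>I. norm (x n j - y0) \<le> 2 * B * (1 - (1/2) ^ n))" for n
  proof (induction n)
    case 0
    show ?case using M h(1) by (auto simp: xS x0 B_def intro!: mult_left_mono)
  next
    case (Suc n)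
    have 2: "norm (x (Suc n) j - y0) \<le> 2 * B * (1 - (1/2) ^ Suc n)" if "j \<in> I" for j
    proof -
      have "norm (x (Suc n) j - y0) \<le> norm (x (Suc n) j - x n j) + norm (x n j - y0)"
        using norm_triangle_ineq[of "x (Suc n) j - x n j" "x n j - y0"] by simp
      also have "\<dots> \<le> B * (1/2) ^ n + 2 * B * (1 - (1/2) ^ n)" using Suc that by (intro add_mono) auto
      finally show ?thesis by (simp add: algebra_simps)
    qed
    have le1: "2 * B * (1 - (1/2) ^ k) \<le> 1" for k :: nat
    proof -
      have "2 * B * (1 - (1/2) ^ k) \<le> 2 * B * 1" using B by (intro mult_left_mono) auto
      with B show ?thesis by linarith
    qed
    have "norm (x (Suc (Suc n)) j - x (Suc n) j) \<le> B * (1/2) ^ Suc n" if "j \<in> I" for j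
    proof -
      have "norm (h *\<^sub>R (\<Psi> (x (Suc n)) j - \<Psi> (x n) j)) \<le> (B * (1/2) ^ n) / 2"
      proof (rule contr[OF that])
        show "norm (x (Suc n) m - y0) \<le> 1" if "m \<in> I" for m using 2[OF that] le1[of "Suc n"] by linarith
        show "norm (x n m - y0) \<le> 1" if "m \<in> I" for m using Suc that le1[of n] by fastforce
        show "norm (x (Suc n) m - x n m) \<le> B * (1/2) ^ n" if "m \<in> I" for m using Suc that by blast
      qed (use B in auto)
      then show ?thesis by (simp add: xS scaleR_diff_right)
    qed
    with 2 show ?case by auto
  qed
  have ball: "norm (x n j - y0) \<le> 2 * B" if "j \<in> I" for n j
  proof -
    have "2 * B * (1 - (1/2) ^ n) \<le> 2 * B * 1" using B by (intro mult_left_mono) auto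
    moreover have "norm (x n j - y0) \<le> 2 * B * (1 - (1/2) ^ n)" using step[of n] that by blast
    ultimately show ?thesis by linarith
  qed
  \<comment> \<open>Dropping the subtracted term gives a rate of convergence that is the same for
    all \<open>j\<close>; this uniformity is what lets \<open>contr\<close> compare an iterate with
    the limit.\<close>
  have tele: "norm (x (n + k) j - x n j) \<le> 2 * B * (1/2) ^ n - 2 * B * (1/2) ^ (n + k)" if "j \<in> I" for n k j
  proof (induction k)
    case (Suc k)
    have "norm (x (n + Suc k) j - x n j) \<le> norm (x (Suc (n + k)) j - x (n + k) j) + norm (x (n + k) j - x n j)"
      using norm_triangle_ineq[of "x (Suc (n + k)) j - x (n + k) j" "x (n + k) j - x n j"] by simp
    also have "\<dots> \<le> B * (1/2) ^ (n + k) + (2 * B * (1/2) ^ n - 2 * B * (1/2) ^ (n + k))"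
      using Suc step[of "n + k"] that by (intro add_mono) auto
    finally show ?case by (simp add: algebra_simps)
  qed simp
  have "\<exists>l. (\<lambda>n. x n j) \<longlonglongrightarrow> l" if "j \<in> I" for j
  proof -
    have "summable (\<lambda>n. x (Suc n) j - x n j)"
    proof (rule summable_comparison_test')
      show "summable (\<lambda>n. B * (1/2) ^ n)" by (intro summable_mult summable_geometric) simp
      show "norm (x (Suc n) j - x n j) \<le> B * (1/2) ^ n" if "0 \<le> n" for n using step[of n] \<open>j \<in> I\<close> by blast
    qed
    then have "(\<lambda>n. \<Sum>i<n. x (Suc i) j - x i j) \<longlonglongrightarrow> (\<Sum>n. x (Suc n) j - x n j)" by (rule summable_LIMSEQ)
    then have "(\<lambda>n. x n j - x 0 j + x 0 j) \<longlonglongrightarrow> (\<Sum>n. x (Suc n) j - x n j) + x 0 j"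
      unfolding sum_lessThan_telescope[of "\<lambda>n. x n j"] by (intro tendsto_add tendsto_const)
    then show ?thesis unfolding diff_add_cancel by (rule exI)
  qed
  then obtain z where z: "\<And>j. j \<in> I \<Longrightarrow> (\<lambda>n. x n j) \<longlonglongrightarrow> z j" by metis
  have zy: "norm (z j - y0) \<le> 2 * B" if "j \<in> I" for j
    using ball[OF that] by (intro tendsto_upperbound[OF tendsto_norm[OF tendsto_diff[OF z[OF that] tendsto_const]]]) auto
  have zx: "norm (x n j - z j) \<le> 2 * B * (1/2) ^ n" if "j \<in> I" for n j
  proof (rule tendsto_upperbound[OF tendsto_norm[OF tendsto_diff[OF tendsto_const LIMSEQ_ignore_initial_segment[OF z[OF that], of n]]]])
    show "\<forall>\<^sub>F k in sequentially. norm (x n j - x (k + n) j) \<le> 2 * B * (1/2) ^ n"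
    proof (rule always_eventually, rule allI)
      fix k
      have "0 \<le> 2 * B * (1/2) ^ (n + k)" using B by simp
      moreover have "norm (x n j - x (k + n) j) = norm (x (n + k) j - x n j)"
        by (subst norm_minus_commute, subst add.commute) (rule refl)
      ultimately show "norm (x n j - x (k + n) j) \<le> 2 * B * (1/2) ^ n"
        using tele[OF that, of n k] by linarith
    qed
  qed auto
  have "z j = y0 + h *\<^sub>R \<Psi> z j" if "j \<in> I" for j
  proof (rule LIMSEQ_unique)
    show "(\<lambda>n. x (Suc n) j) \<longlonglongrightarrow> z j" using z[OF that] by (rule LIMSEQ_Suc)
    have "(\<lambda>n. x (Suc n) j - (y0 + h *\<^sub>R \<Psi> z j)) \<longlonglongrightarrow> 0"
    proof (rule Lim_null_comparison)
      show "\<forall>\<^sub>F n in sequentially. norm (x (Suc n) j - (y0 + h *\<^sub>R \<Psi> z j)) \<le> (2 * B * (1/2) ^ n) / 2"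
      proof (rule always_eventually, rule allI)
        fix n
        have "norm (h *\<^sub>R (\<Psi> (x n) j - \<Psi> z j)) \<le> (2 * B * (1/2) ^ n) / 2"
        proof (rule contr[OF that])
          show "norm (x n m - y0) \<le> 1" if "m \<in> I" for m using ball[OF that, of n] B by linarith
          show "norm (z m - y0) \<le> 1" if "m \<in> I" for m using zy[OF that] B by linarith
        qed (use B zx in auto)
        then show "norm (x (Suc n) j - (y0 + h *\<^sub>R \<Psi> z j)) \<le> (2 * B * (1/2) ^ n) / 2"
          by (simp add: xS scaleR_diff_right)
      qed
      have "(\<lambda>n. (1/2::real) ^ n) \<longlonglongrightarrow> 0" by (rule LIMSEQ_power_zero) simp
      from tendsto_mult_right_zero[OF this, of B] show "(\<lambda>n. (2 * B * (1/2) ^ n) / 2) \<longlonglongrightarrow> 0" by simp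
    qed
    then show "(\<lambda>n. x (Suc n) j) \<longlonglongrightarrow> y0 + h *\<^sub>R \<Psi> z j" by (simp add: LIM_zero_iff)
  qed
  with zy show ?thesis unfolding B_def mult.assoc by blast
qed

text \<open>For small h both h K and h M fall below 1/2, and the bound 2 h M on the distance to
  \<open>y0\<close> then forces the required convergence.\<close>

lemma ark_stages_exist:
  fixes u :: "'q \<Rightarrow> real^'n \<Rightarrow> real^'n" and I :: "'i set"
  assumes fin: "finite Q" "finite I" and u: "\<And>q. q \<in> Q \<Longrightarrow> C_diff (Suc m) (u q)"
  shows "\<exists>z. (\<forall>\<^sub>F h in at_right 0. \<forall>j\<in>I. z h j = y0 + h *\<^sub>R (\<Sum>q\<in>Q. \<Sum>m\<in>I. A q j m *\<^sub>R u q (z h m))) \<and>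
    (\<forall>j\<in>I. ((\<lambda>h. z h j) \<longlongrightarrow> y0) (at_right 0))"
proof -
  have "\<forall>q. \<exists>L. q \<in> Q \<longrightarrow> 0 \<le> L \<and> (\<forall>x\<in>cball y0 1. \<forall>y\<in>cball y0 1. norm (u q x - u q y) \<le> L * norm (x - y))"
    using C_diff_Lipschitz[OF u compact_cball[of y0 1] convex_cball] by meson
  from choice[OF this] obtain L where L: "\<And>q. q \<in> Q \<Longrightarrow> 0 \<le> L q"
    "\<And>q x y. q \<in> Q \<Longrightarrow> x \<in> cball y0 1 \<Longrightarrow> y \<in> cball y0 1 \<Longrightarrow> norm (u q x - u q y) \<le> L q * norm (x - y)"
    by metis
  let ?\<Psi> = "\<lambda>z j. \<Sum>q\<in>Q. \<Sum>m\<in>I. A q j m *\<^sub>R u q (z m)"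
  \<comment> \<open>Summing over all rows as well gives one constant valid for every stage: the
    bound for row \<open>j\<close> is a single nonnegative summand. The same holds for
    \<open>M\<close>.\<close>
  define K where "K = (\<Sum>j\<in>I. \<Sum>q\<in>Q. \<Sum>m\<in>I. \<bar>A q j m\<bar> * L q)"
  define M where "M = (\<Sum>j\<in>I. \<Sum>q\<in>Q. \<Sum>m\<in>I. \<bar>A q j m\<bar> * norm (u q y0))"
  have KM: "0 \<le> M" unfolding M_def by (intro sum_nonneg) auto
  have solve: "\<exists>z. \<forall>j\<in>I. z j = y0 + h *\<^sub>R ?\<Psi> z j \<and> norm (z j - y0) \<le> 2 * h * M"
    if h: "0 \<le> h" "h * K \<le> 1 / 2" "h * M \<le> 1 / 2" for h
  proof (rule stage_equations_solvable[OF _ _ KM h])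
    fix x y :: "'i \<Rightarrow> real^'n" and j \<epsilon>
    assume j: "j \<in> I" and xy: "\<And>m. m \<in> I \<Longrightarrow> norm (x m - y0) \<le> 1" "\<And>m. m \<in> I \<Longrightarrow> norm (y m - y0) \<le> 1"
      "\<And>m. m \<in> I \<Longrightarrow> norm (x m - y m) \<le> \<epsilon>"
    have \<epsilon>: "0 \<le> \<epsilon>" using xy(3)[OF j] norm_ge_zero order_trans by blast
    have "norm (?\<Psi> x j - ?\<Psi> y j) \<le> (\<Sum>q\<in>Q. \<Sum>m\<in>I. (\<bar>A q j m\<bar> * L q) * \<epsilon>)"
      unfolding sum_subtractf[symmetric] scaleR_diff_right[symmetric]
    proof (intro sum_norm_le)
      fix q m assume q: "q \<in> Q" and m: "m \<in> I"
      have "norm (u q (x m) - u q (y m)) \<le> L q * norm (x m - y m)"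
        using xy(1,2)[OF m] by (intro L(2)[OF q]) (auto simp: dist_norm norm_minus_commute)
      also have "\<dots> \<le> L q * \<epsilon>" by (intro mult_left_mono xy(3) m L(1) q)
      finally show "norm (A q j m *\<^sub>R (u q (x m) - u q (y m))) \<le> \<bar>A q j m\<bar> * L q * \<epsilon>"
        by (simp add: mult.assoc mult_left_mono)
    qed
    also have "\<dots> = (\<Sum>q\<in>Q. \<Sum>m\<in>I. \<bar>A q j m\<bar> * L q) * \<epsilon>"
      by (simp only: sum_distrib_right)
    also have "\<dots> \<le> K * \<epsilon>"
      unfolding K_def
      by (rule mult_right_mono[OF member_le_sum[OF j _ fin(2)] \<epsilon>]) (intro sum_nonneg mult_nonneg_nonneg L(1); simp)
    finally show "norm (?\<Psi> x j - ?\<Psi> y j) \<le> K * \<epsilon>" .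
  next
    fix j assume j: "j \<in> I"
    have "norm (\<Sum>q\<in>Q. \<Sum>m\<in>I. A q j m *\<^sub>R u q y0) \<le> (\<Sum>q\<in>Q. \<Sum>m\<in>I. \<bar>A q j m\<bar> * norm (u q y0))"
      by (intro sum_norm_le) simp
    also have "\<dots> \<le> M"
      unfolding M_def by (rule member_le_sum[OF j _ fin(2)]) (intro sum_nonneg; simp)
    finally show "norm (\<Sum>q\<in>Q. \<Sum>m\<in>I. A q j m *\<^sub>R u q y0) \<le> M" .
  qed
  then have "\<forall>h. \<exists>z. 0 \<le> h \<longrightarrow> h * K \<le> 1 / 2 \<longrightarrow> h * M \<le> 1 / 2 \<longrightarrow>
      (\<forall>j\<in>I. z j = y0 + h *\<^sub>R ?\<Psi> z j \<and> norm (z j - y0) \<le> 2 * h * M)"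
    by meson
  from choice[OF this] obtain z where z: "\<And>h. 0 \<le> h \<Longrightarrow> h * K \<le> 1 / 2 \<Longrightarrow> h * M \<le> 1 / 2 \<Longrightarrow>
      (\<forall>j\<in>I. z h j = y0 + h *\<^sub>R ?\<Psi> (z h) j \<and> norm (z h j - y0) \<le> 2 * h * M)"
    by blast
  have small: "\<forall>\<^sub>F h in at_right 0. h * B \<le> 1 / 2" for B :: real
  proof -
    have "((\<lambda>h. h * B) \<longlongrightarrow> 0 * B) (at_right 0)" by (intro tendsto_intros)
    then have "\<forall>\<^sub>F h in at_right 0. h * B < 1 / 2" by (rule order_tendstoD) simp
    then show ?thesis by eventually_elim simp
  qed
  have ev: "\<forall>\<^sub>F h in at_right 0. \<forall>j\<in>I. z h j = y0 + h *\<^sub>R ?\<Psi> (z h) j \<and> norm (z h j - y0) \<le> 2 * h * M"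
    using eventually_small small[of K] small[of M] by eventually_elim (rule z; simp)
  have "((\<lambda>h. z h j) \<longlongrightarrow> y0) (at_right 0)" if "j \<in> I" for j
  proof (rule vbigo_tendsto)
    have "\<forall>\<^sub>F h in at_right 0. norm (z h j - y0) \<le> (2 * M) * h ^ Suc 0"
      using ev
    proof eventually_elim
      case (elim h)
      then have "norm (z h j - y0) \<le> 2 * h * M" using that by blast
      then show ?case by (simp add: mult_ac)
    qed
    then show "vbigo (Suc 0) (\<lambda>h. z h j - y0)" unfolding vbigo_def by blast
  qed
  moreover have "\<forall>\<^sub>F h in at_right 0. \<forall>j\<in>I. z h j = y0 + h *\<^sub>R ?\<Psi> (z h) j"
    using ev by eventually_elim blast
  ultimately show ?thesis by (intro exI[of _ z] conjI ballI)
qed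

section \<open>Local error of additive Runge--Kutta methods\<close>

lemma sum_lessThan_4: "(\<Sum>k<4. f k) = f 0 + f 1 + f 2 + f (3::nat)"
  by (simp add: numeral_eq_Suc)

text \<open>
  Additive Runge--Kutta methods with one set \<open>I\<close> of stages and parts \<open>u q\<close>, \<open>q \<in> Q\<close>, of the right-hand side.
  The polynomial with coefficients \<open>a\<close> stands for the exact solution: unlike the latter, it can be
  evaluated at abscissae outside $[0, 1]$, which the inner method may have.
\<close>

locale ark_expansion =
  fixes Q :: "'q set" and I :: "'i set" and A :: "'q \<Rightarrow> 'i \<Rightarrow> 'i \<Rightarrow> real" and b c :: "'i \<Rightarrow> real"
    and u :: "'q \<Rightarrow> real^'n \<Rightarrow> real^'n" and y0 :: "real^'n" and a :: "nat \<Rightarrow> real^'n"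
    and \<phi> :: "'q \<Rightarrow> nat \<Rightarrow> real^'n" and z :: "real \<Rightarrow> 'i \<Rightarrow> real^'n"
  assumes smooth: "q \<in> Q \<Longrightarrow> C_diff 4 (u q)"
    and stages: "\<forall>\<^sub>F h in at_right 0. \<forall>j\<in>I. z h j = y0 + h *\<^sub>R (\<Sum>q\<in>Q. \<Sum>m\<in>I. A q j m *\<^sub>R u q (z h m))"
    and stages_tendsto: "j \<in> I \<Longrightarrow> ((\<lambda>h. z h j) \<longlongrightarrow> y0) (at_right 0)"
    and row_sum: "q \<in> Q \<Longrightarrow> j \<in> I \<Longrightarrow> (\<Sum>m\<in>I. A q j m) = c j"
    and a_0: "a 0 = y0"
    and a_Suc: "k < 4 \<Longrightarrow> a (Suc k) = inverse (real (Suc k)) *\<^sub>R (\<Sum>q\<in>Q. \<phi> q k)"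
    and \<phi>: "q \<in> Q \<Longrightarrow> vbigo 4 (\<lambda>h. u q (\<Sum>j<5. (s * h) ^ j *\<^sub>R a j) - (\<Sum>k<4. h ^ k *\<^sub>R (s ^ k *\<^sub>R \<phi> q k)))"
begin

definition taylor :: "real \<Rightarrow> real^'n" where
  "taylor t = (\<Sum>j<5. t ^ j *\<^sub>R a j)"

text \<open>Residual of the simplifying assumption C(k+1) of Runge--Kutta theory: the error of row
  \<open>j\<close>, read as a quadrature rule on the interval from 0 to c_j, for the monomial
  t^k.\<close>

definition defect :: "'q \<Rightarrow> nat \<Rightarrow> 'i \<Rightarrow> real" where
  "defect q k j = (\<Sum>m\<in>I. A q j m * c m ^ k) - c j ^ Suc k / real (Suc k)"

text \<open>Coefficient of \<open>h ^ Suc k\<close> in the residual of stage equation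
  \<open>j\<close> when every stage value is replaced by the Taylor polynomial at its
  abscissa.\<close>

definition defect_term :: "nat \<Rightarrow> 'i \<Rightarrow> real^'n" where
  "defect_term k j = (\<Sum>q\<in>Q. defect q k j *\<^sub>R \<phi> q k)"

abbreviation du :: "'q \<Rightarrow> 'i \<Rightarrow> real \<Rightarrow> real^'n" where
  "du q m h \<equiv> u q (z h m) - u q (taylor (c m * h))"

lemma taylor_expand: "taylor (s * h) = y0 + (\<Sum>k<4. h ^ Suc k *\<^sub>R (s ^ Suc k *\<^sub>R a (Suc k)))"
proof -
  have "taylor (s * h) = (\<Sum>j<Suc 4. (s * h) ^ j *\<^sub>R a j)" by (simp add: taylor_def)
  also have "\<dots> = a 0 + (\<Sum>k<4. (s * h) ^ Suc k *\<^sub>R a (Suc k))"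
    unfolding sum.lessThan_Suc_shift by simp
  finally show ?thesis by (simp only: a_0 power_mult_distrib scaleR_scaleR mult.commute)
qed

lemma vbigo_taylor: "vbigo 1 (\<lambda>h. taylor (s * h) - y0)"
  unfolding taylor_expand add_diff_cancel_left' by (intro vbigo_sum vbigo_monom) simp

lemma taylor_tendsto: "((\<lambda>h. taylor (s * h)) \<longlongrightarrow> y0) (at_right 0)"
  using vbigo_taylor[of s] unfolding One_nat_def by (rule vbigo_tendsto)

text \<open>Splits the error into the quadrature error along the Taylor polynomial and the
  propagated stage deviations. General weights allow two uses: a row of \<open>A\<close> with s =
  c_j for a stage, and \<open>b\<close> with s = 1 for the step.\<close>

lemma quadrature_expansion:
  "vbigo 5 (\<lambda>h. y0 + h *\<^sub>R (\<Sum>q\<in>Q. \<Sum>m\<in>I. w q m *\<^sub>R u q (z h m)) - taylor (s * h)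
     - (\<Sum>k<4. h ^ Suc k *\<^sub>R (\<Sum>q\<in>Q. ((\<Sum>m\<in>I. w q m * c m ^ k) - s ^ Suc k / real (Suc k)) *\<^sub>R \<phi> q k))
     - h *\<^sub>R (\<Sum>q\<in>Q. \<Sum>m\<in>I. w q m *\<^sub>R du q m h))"
    (is "vbigo 5 ?f")
proof -
  let ?T = "\<lambda>q m h. \<Sum>k<4. h ^ k *\<^sub>R (c m ^ k *\<^sub>R \<phi> q k)"
  let ?S = "\<lambda>q k. \<Sum>m\<in>I. w q m * c m ^ k"
  have 1: "(\<Sum>m\<in>I. w q m *\<^sub>R ?T q m h) = (\<Sum>k<4. h ^ k *\<^sub>R (?S q k *\<^sub>R \<phi> q k))" for q h
    unfolding scaleR_sum_right scaleR_sum_left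
    by (subst sum.swap) (simp add: mult_ac)
  have 2: "h *\<^sub>R (\<Sum>q\<in>Q. \<Sum>m\<in>I. w q m *\<^sub>R ?T q m h) = (\<Sum>k<4. h ^ Suc k *\<^sub>R (\<Sum>q\<in>Q. ?S q k *\<^sub>R \<phi> q k))" for h
  proof -
    have "h *\<^sub>R (\<Sum>q\<in>Q. \<Sum>m\<in>I. w q m *\<^sub>R ?T q m h) = (\<Sum>q\<in>Q. \<Sum>k<4. h ^ Suc k *\<^sub>R (?S q k *\<^sub>R \<phi> q k))"
      by (simp only: 1) (simp add: scaleR_sum_right mult_ac)
    also have "\<dots> = (\<Sum>k<4. h ^ Suc k *\<^sub>R (\<Sum>q\<in>Q. ?S q k *\<^sub>R \<phi> q k))"
      unfolding scaleR_sum_right by (rule sum.swap)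
    finally show ?thesis .
  qed
  have 3: "taylor (s * h) = y0 + (\<Sum>k<4. h ^ Suc k *\<^sub>R (\<Sum>q\<in>Q. (s ^ Suc k / real (Suc k)) *\<^sub>R \<phi> q k))" for h
    unfolding taylor_expand
    by (intro arg_cong2[where f = "(+)"] sum.cong refl arg_cong2[where f = scaleR])
       (simp only: a_Suc lessThan_iff scaleR_scaleR divide_inverse scaleR_sum_right)
  \<comment> \<open>After cancellation only the remainders of the expansions of the
    \<open>u q\<close> are left; they have order four, and the outer factor h supplies the fifth
    power.\<close>
  have eq: "?f h = h *\<^sub>R (\<Sum>q\<in>Q. \<Sum>m\<in>I. w q m *\<^sub>R (u q (taylor (c m * h)) - ?T q m h))" for h
    unfolding 3 scaleR_left_diff_distrib sum_subtractf scaleR_diff_right 2 by simp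
  show ?thesis unfolding eq
    using \<phi> by (intro vbigo_Suc_scaleR[where k = 4, simplified] vbigo_sum vbigo_scaleR) (simp add: taylor_def)
qed

text \<open>The bootstrapping step: since h multiplies the sum, an approximation \<psi> of
  \<open>du\<close> to order k yields the stage to order k + 1. It is used with \<psi> = 0 up to
  order three and then with the leading term of \<open>du\<close>.\<close>

lemma stage_expansion:
  assumes "j \<in> I" "k \<le> 4" and \<psi>: "\<And>q m. q \<in> Q \<Longrightarrow> m \<in> I \<Longrightarrow> vbigo k (\<lambda>h. du q m h - \<psi> q m h)"
  shows "vbigo (Suc k) (\<lambda>h. z h j - taylor (c j * h) - (h^2 *\<^sub>R defect_term 1 j + h^3 *\<^sub>R defect_term 2 j + h^4 *\<^sub>R defect_term 3 j)
    - h *\<^sub>R (\<Sum>q\<in>Q. \<Sum>m\<in>I. A q j m *\<^sub>R \<psi> q m h))"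
proof -
  have D0: "defect_term 0 j = 0" using row_sum[OF _ assms(1)] by (simp add: defect_term_def defect_def)
  have "vbigo 5 (\<lambda>h. y0 + h *\<^sub>R (\<Sum>q\<in>Q. \<Sum>m\<in>I. A q j m *\<^sub>R u q (z h m)) - taylor (c j * h)
     - (\<Sum>k<4. h ^ Suc k *\<^sub>R defect_term k j) - h *\<^sub>R (\<Sum>q\<in>Q. \<Sum>m\<in>I. A q j m *\<^sub>R du q m h))"
    unfolding defect_term_def defect_def by (rule quadrature_expansion)
  then have "vbigo 5 (\<lambda>h. z h j - taylor (c j * h)
     - (\<Sum>k<4. h ^ Suc k *\<^sub>R defect_term k j) - h *\<^sub>R (\<Sum>q\<in>Q. \<Sum>m\<in>I. A q j m *\<^sub>R du q m h))"
    by (rule vbigo_cong) (use stages assms(1) in \<open>auto elim!: eventually_mono\<close>)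
  then have 1: "vbigo (Suc k) (\<lambda>h. z h j - taylor (c j * h)
     - (\<Sum>k<4. h ^ Suc k *\<^sub>R defect_term k j) - h *\<^sub>R (\<Sum>q\<in>Q. \<Sum>m\<in>I. A q j m *\<^sub>R du q m h))"
    by (rule vbigo_mono) (use assms(2) in simp)
  have 2: "vbigo (Suc k) (\<lambda>h. h *\<^sub>R (\<Sum>q\<in>Q. \<Sum>m\<in>I. A q j m *\<^sub>R (du q m h - \<psi> q m h)))"
    by (intro vbigo_Suc_scaleR vbigo_sum vbigo_scaleR \<psi>)
  have sum4: "(\<Sum>k<4. h ^ Suc k *\<^sub>R defect_term k j) = h^2 *\<^sub>R defect_term 1 j + h^3 *\<^sub>R defect_term 2 j + h^4 *\<^sub>R defect_term 3 j" for h
    unfolding sum_lessThan_4 D0 by (simp add: numeral_eq_Suc)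
  show ?thesis
    unfolding sum4[symmetric]
    by (rule vbigo_eq[OF vbigo_add[OF 1 2]]) (simp add: scaleR_diff_right sum_subtractf del: power_Suc)
qed

section \<open>Stage deviations, one order at a time\<close>

lemma C_diff_u: "q \<in> Q \<Longrightarrow> C_diff (Suc (Suc (Suc (Suc 0)))) (u q)"
proof -
  have "4 = Suc (Suc (Suc (Suc 0)))" by simp
  then show "q \<in> Q \<Longrightarrow> C_diff (Suc (Suc (Suc (Suc 0)))) (u q)" using smooth[of q] by argo
qed

lemma vbigo_du:
  assumes "q \<in> Q" "m \<in> I" "vbigo k (\<lambda>h. z h m - taylor (c m * h))"
  shows "vbigo k (du q m)"
  by (rule vbigo_compose_diff[OF C_diff_u[OF assms(1)] taylor_tendsto stages_tendsto[OF assms(2)] assms(3)])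

text \<open>Start of the bootstrapping: convergence of the stages only makes the values of
  \<open>u q\<close> bounded, but the factor h in the stage equations already turns this into first
  order.\<close>

lemma stage_1:
  assumes "j \<in> I"
  shows "vbigo 1 (\<lambda>h. z h j - taylor (c j * h))"
proof -
  have "vbigo 0 (\<lambda>h. u q (z h m))" if "q \<in> Q" "m \<in> I" for q m
  proof (rule vbigo_0_tendsto)
    have "isCont (u q) y0"
      using C_diff_continuous_on[OF smooth[OF that(1)], of UNIV] by (simp add: continuous_on_eq_continuous_at)
    then show "((\<lambda>h. u q (z h m)) \<longlongrightarrow> u q y0) (at_right 0)"
      by (rule isCont_tendsto_compose) (rule stages_tendsto[OF that(2)])
  qed
  then have "vbigo (Suc 0) (\<lambda>h. h *\<^sub>R (\<Sum>q\<in>Q. \<Sum>m\<in>I. A q j m *\<^sub>R u q (z h m)))"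
    by (intro vbigo_Suc_scaleR vbigo_sum vbigo_scaleR)
  then have "vbigo 1 (\<lambda>h. z h j - y0)"
    unfolding One_nat_def by (rule vbigo_cong) (use stages assms in \<open>auto elim!: eventually_mono\<close>)
  from vbigo_diff[OF this vbigo_taylor] show ?thesis by simp
qed

lemma stage_2:
  assumes "j \<in> I"
  shows "vbigo 2 (\<lambda>h. z h j - taylor (c j * h))"
proof -
  have "vbigo (Suc 1) (\<lambda>h. z h j - taylor (c j * h) - (h^2 *\<^sub>R defect_term 1 j + h^3 *\<^sub>R defect_term 2 j + h^4 *\<^sub>R defect_term 3 j)
    - h *\<^sub>R (\<Sum>q\<in>Q. \<Sum>m\<in>I. A q j m *\<^sub>R 0))"
    using assms by (rule stage_expansion) (use vbigo_du stage_1 in \<open>simp_all\<close>)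
  then have "vbigo 2 (\<lambda>h. z h j - taylor (c j * h) - (h^2 *\<^sub>R defect_term 1 j + h^3 *\<^sub>R defect_term 2 j + h^4 *\<^sub>R defect_term 3 j))"
    by (simp add: numeral_2_eq_2)
  moreover have "vbigo 2 (\<lambda>h. h^2 *\<^sub>R defect_term 1 j + h^3 *\<^sub>R defect_term 2 j + h^4 *\<^sub>R defect_term 3 j)"
    by (intro vbigo_add vbigo_monom) simp_all
  ultimately have "vbigo 2 (\<lambda>h. z h j - taylor (c j * h) - (h^2 *\<^sub>R defect_term 1 j + h^3 *\<^sub>R defect_term 2 j + h^4 *\<^sub>R defect_term 3 j) + (h^2 *\<^sub>R defect_term 1 j + h^3 *\<^sub>R defect_term 2 j + h^4 *\<^sub>R defect_term 3 j))"
    by (rule vbigo_add)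
  then show ?thesis by (rule vbigo_eq) simp
qed

lemma stage_3:
  assumes "j \<in> I"
  shows "vbigo 3 (\<lambda>h. z h j - taylor (c j * h) - h^2 *\<^sub>R defect_term 1 j)"
proof -
  have "vbigo (Suc 2) (\<lambda>h. z h j - taylor (c j * h) - (h^2 *\<^sub>R defect_term 1 j + h^3 *\<^sub>R defect_term 2 j + h^4 *\<^sub>R defect_term 3 j)
    - h *\<^sub>R (\<Sum>q\<in>Q. \<Sum>m\<in>I. A q j m *\<^sub>R 0))"
    using assms by (rule stage_expansion) (use vbigo_du stage_2 in \<open>simp_all\<close>)
  then have "vbigo 3 (\<lambda>h. z h j - taylor (c j * h) - (h^2 *\<^sub>R defect_term 1 j + h^3 *\<^sub>R defect_term 2 j + h^4 *\<^sub>R defect_term 3 j))"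
    by (simp add: numeral_3_eq_3 numeral_2_eq_2)
  moreover have "vbigo 3 (\<lambda>h. h^3 *\<^sub>R defect_term 2 j + h^4 *\<^sub>R defect_term 3 j)"
    by (intro vbigo_add vbigo_monom) simp_all
  ultimately have "vbigo 3 (\<lambda>h. z h j - taylor (c j * h) - (h^2 *\<^sub>R defect_term 1 j + h^3 *\<^sub>R defect_term 2 j + h^4 *\<^sub>R defect_term 3 j) + (h^3 *\<^sub>R defect_term 2 j + h^4 *\<^sub>R defect_term 3 j))"
    by (rule vbigo_add)
  then show ?thesis by (rule vbigo_eq) simp
qed

abbreviation Du :: "'q \<Rightarrow> real^'n \<Rightarrow> real^'n \<Rightarrow> real^'n" where
  "Du q x \<equiv> frechet_derivative (u q) (at x)"

lemma linear_Du: "q \<in> Q \<Longrightarrow> linear (Du q x)"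
  using C_diff_has_derivative[OF C_diff_u, of q x UNIV] by (simp add: has_derivative_linear)

text \<open>The square of a deviation of order two has the full accuracy needed for
  \<open>du\<close>. Second derivatives therefore enter only through the variation of the Jacobian
  along the Taylor polynomial.\<close>

lemma du_linearization:
  assumes "q \<in> Q" "m \<in> I"
  shows "vbigo 4 (\<lambda>h. du q m h - Du q (taylor (c m * h)) (z h m - taylor (c m * h)))"
  using vbigo_compose_linearization[OF C_diff_u[OF assms(1)] taylor_tendsto stages_tendsto[OF assms(2)] stage_2[OF assms(2)]]
  by simp

lemma du_3:
  assumes q: "q \<in> Q" and m: "m \<in> I"
  shows "vbigo 3 (\<lambda>h. du q m h - h^2 *\<^sub>R Du q y0 (defect_term 1 m))"
proof -
  let ?\<delta> = "\<lambda>h. z h m - taylor (c m * h)"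
  have 1: "vbigo 3 (\<lambda>h. du q m h - Du q (taylor (c m * h)) (?\<delta> h))"
    using du_linearization[OF assms] by (rule vbigo_mono) simp
  have 2: "vbigo 3 (\<lambda>h. Du q (taylor (c m * h)) (?\<delta> h) - Du q y0 (?\<delta> h))"
    using vbigo_derivative_diff[OF C_diff_u[OF q] vbigo_taylor[of "c m", unfolded One_nat_def] stage_2[OF m]] by (simp add: numeral_3_eq_3)
  have 3: "vbigo 3 (\<lambda>h. Du q y0 (?\<delta> h - h^2 *\<^sub>R defect_term 1 m))"
    by (rule vbigo_derivative[OF C_diff_u[OF q] tendsto_const stage_3[OF m]])
  show ?thesis
    by (rule vbigo_eq[OF vbigo_add[OF vbigo_add[OF 1 2] 3]])
       (simp add: linear_diff[OF linear_Du[OF q]] linear_scale[OF linear_Du[OF q]])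
qed

text \<open>Coefficient of \<open>h ^ 3\<close> in the deviation of stage \<open>j\<close>: its own
  defect plus the quadratic deviations of all stages, passed through the Jacobians at
  \<open>y0\<close>.\<close>

definition cubic_term :: "'i \<Rightarrow> real^'n" where
  "cubic_term j = defect_term 2 j + (\<Sum>q\<in>Q. \<Sum>m\<in>I. A q j m *\<^sub>R Du q y0 (defect_term 1 m))"

lemma stage_4:
  assumes "j \<in> I"
  shows "vbigo 4 (\<lambda>h. z h j - taylor (c j * h) - (h^2 *\<^sub>R defect_term 1 j + h^3 *\<^sub>R cubic_term j))"
proof -
  have "vbigo (Suc 3) (\<lambda>h. z h j - taylor (c j * h) - (h^2 *\<^sub>R defect_term 1 j + h^3 *\<^sub>R defect_term 2 j + h^4 *\<^sub>R defect_term 3 j)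
    - h *\<^sub>R (\<Sum>q\<in>Q. \<Sum>m\<in>I. A q j m *\<^sub>R (h^2 *\<^sub>R Du q y0 (defect_term 1 m))))"
    using assms by (rule stage_expansion) (use du_3 in simp_all)
  moreover have "Suc 3 = 4" by simp
  moreover have "h *\<^sub>R (\<Sum>q\<in>Q. \<Sum>m\<in>I. A q j m *\<^sub>R (h^2 *\<^sub>R Du q y0 (defect_term 1 m)))
      = h^3 *\<^sub>R (\<Sum>q\<in>Q. \<Sum>m\<in>I. A q j m *\<^sub>R Du q y0 (defect_term 1 m))" for h
    by (simp add: scaleR_sum_right power3_eq_cube power2_eq_square mult_ac)
  ultimately have "vbigo 4 (\<lambda>h. z h j - taylor (c j * h) - (h^2 *\<^sub>R defect_term 1 j + h^3 *\<^sub>R defect_term 2 j + h^4 *\<^sub>R defect_term 3 j)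
    - h^3 *\<^sub>R (\<Sum>q\<in>Q. \<Sum>m\<in>I. A q j m *\<^sub>R Du q y0 (defect_term 1 m)))"
    by simp
  moreover have "vbigo 4 (\<lambda>h. h^4 *\<^sub>R defect_term 3 j)" by (rule vbigo_monom) simp
  ultimately have "vbigo 4 (\<lambda>h. z h j - taylor (c j * h) - (h^2 *\<^sub>R defect_term 1 j + h^3 *\<^sub>R defect_term 2 j + h^4 *\<^sub>R defect_term 3 j)
    - h^3 *\<^sub>R (\<Sum>q\<in>Q. \<Sum>m\<in>I. A q j m *\<^sub>R Du q y0 (defect_term 1 m)) + h^4 *\<^sub>R defect_term 3 j)"
    by (rule vbigo_add)
  then show ?thesis by (rule vbigo_eq) (simp add: cubic_term_def scaleR_add_right)
qed

text \<open>The family \<psi> is chosen before the stage. The dependence on \<open>m\<close> is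
  confined to \<open>defect r 1 m\<close>, \<open>c m\<close> and \<open>cubic_term m\<close>, so
  weighting by \<open>b\<close> leaves only b D_1, (b c) D_1 and the weighted sum of the cubic
  terms. The vectors \<psi> r k come from expanding the Jacobian of \<open>u q\<close>, applied to
  \<phi> r 1, along the Taylor polynomial at c_m h.\<close>

lemma du_4:
  assumes q: "q \<in> Q"
  shows "\<exists>\<psi> :: 'q \<Rightarrow> nat \<Rightarrow> real^'n. \<forall>m\<in>I. vbigo 4 (\<lambda>h. du q m h - (h^2 *\<^sub>R (\<Sum>r\<in>Q. defect r 1 m *\<^sub>R (\<psi> r 0 + h *\<^sub>R c m *\<^sub>R \<psi> r 1))
    + h^3 *\<^sub>R Du q y0 (cubic_term m)))"
proof -
  have "\<exists>\<psi>. \<forall>s. vbigo 2 (\<lambda>h. Du q (taylor (s * h)) v - (\<Sum>k<2. h ^ k *\<^sub>R (s ^ k *\<^sub>R \<psi> k)))" for v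
    unfolding taylor_def
  proof (rule C_diff_poly_expansion)
    have "C_diff (Suc (Suc (Suc 0))) (\<lambda>x. Du q x v)"
      using C_diff_u[OF q] unfolding C_diff.simps(2)[of "Suc (Suc (Suc 0))"] by blast
    from C_diff_SucD[OF this] show "C_diff 2 (\<lambda>x. Du q x v)" by (simp only: numeral_2_eq_2)
  qed
  then have "\<forall>r. \<exists>\<psi>. \<forall>s. vbigo 2 (\<lambda>h. Du q (taylor (s * h)) (\<phi> r 1) - (\<Sum>k<2. h ^ k *\<^sub>R (s ^ k *\<^sub>R \<psi> k)))"
    by (rule allI)
  from choice[OF this] obtain \<psi> where \<psi>: "\<forall>r s. vbigo 2 (\<lambda>h. Du q (taylor (s * h)) (\<phi> r 1) - (\<Sum>k<2. h ^ k *\<^sub>R (s ^ k *\<^sub>R \<psi> r k)))"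
    by (rule exE)
  have "vbigo 4 (\<lambda>h. du q m h - (h^2 *\<^sub>R (\<Sum>r\<in>Q. defect r 1 m *\<^sub>R (\<psi> r 0 + h *\<^sub>R c m *\<^sub>R \<psi> r 1))
    + h^3 *\<^sub>R Du q y0 (cubic_term m)))" if m: "m \<in> I" for m
  proof -
    let ?\<delta> = "\<lambda>h. z h m - taylor (c m * h)"
    \<comment> \<open>Despite its name, \<open>?defect h\<close> is the derivative of
      \<open>u q\<close> at the Taylor polynomial, a linear map, and not one of the quadrature
      residuals.\<close>
    let ?defect = "\<lambda>h. Du q (taylor (c m * h))"
    have 1: "vbigo 4 (\<lambda>h. du q m h - ?defect h (?\<delta> h))" by (rule du_linearization[OF q m])
    have 2: "vbigo 4 (\<lambda>h. ?defect h (?\<delta> h - (h^2 *\<^sub>R defect_term 1 m + h^3 *\<^sub>R cubic_term m)))"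
      by (rule vbigo_derivative[OF C_diff_u[OF q] taylor_tendsto stage_4[OF m]])
    \<comment> \<open>The cubic term already carries h^3, so freezing the derivative at
      \<open>y0\<close> costs only O(h^4). The quadratic term cannot afford this; for it the
      derivative is expanded one order further.\<close>
    have "vbigo (Suc 0 + 0) (\<lambda>h. ?defect h (cubic_term m) - Du q y0 (cubic_term m))"
      by (rule vbigo_derivative_diff[OF C_diff_u[OF q] vbigo_taylor[of "c m", unfolded One_nat_def] vbigo_const])
    from vbigo_power_scaleR[OF this, of 3] have 3: "vbigo 4 (\<lambda>h. h^3 *\<^sub>R (?defect h (cubic_term m) - Du q y0 (cubic_term m)))" by simp
    have Du_E: "?defect h (defect_term 1 m) = (\<Sum>r\<in>Q. defect r 1 m *\<^sub>R ?defect h (\<phi> r 1))" for h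
      unfolding defect_term_def by (simp add: linear_sum[OF linear_Du[OF q]] linear_scale[OF linear_Du[OF q]])
    have "vbigo 2 (\<lambda>h. \<Sum>r\<in>Q. defect r 1 m *\<^sub>R (?defect h (\<phi> r 1) - (\<Sum>k<2. h ^ k *\<^sub>R (c m ^ k *\<^sub>R \<psi> r k))))"
      by (intro vbigo_sum vbigo_scaleR \<psi>[rule_format])
    then have "vbigo 2 (\<lambda>h. ?defect h (defect_term 1 m) - (\<Sum>r\<in>Q. defect r 1 m *\<^sub>R (\<psi> r 0 + h *\<^sub>R c m *\<^sub>R \<psi> r 1)))"
      unfolding Du_E by (simp only: scaleR_diff_right sum_subtractf numeral_2_eq_2 sum.lessThan_Suc lessThan_0 sum.empty power_Suc power_0 mult_1_right scaleR_one add_0_left One_nat_def)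
    from vbigo_power_scaleR[OF this, of 2]
    have 4: "vbigo 4 (\<lambda>h. h^2 *\<^sub>R (?defect h (defect_term 1 m) - (\<Sum>r\<in>Q. defect r 1 m *\<^sub>R (\<psi> r 0 + h *\<^sub>R c m *\<^sub>R \<psi> r 1))))" by simp
    show ?thesis
      by (rule vbigo_eq[OF vbigo_add[OF vbigo_add[OF vbigo_add[OF 1 2] 3] 4]])
         (simp add: linear_diff[OF linear_Du[OF q]] linear_add[OF linear_Du[OF q]] linear_scale[OF linear_Du[OF q]] scaleR_diff_right)
  qed
  then have "\<forall>m\<in>I. vbigo 4 (\<lambda>h. du q m h - (h^2 *\<^sub>R (\<Sum>r\<in>Q. defect r 1 m *\<^sub>R (\<psi> r 0 + h *\<^sub>R c m *\<^sub>R \<psi> r 1))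
    + h^3 *\<^sub>R Du q y0 (cubic_term m)))"
    by (rule ballI)
  then show ?thesis by - (rule exI[of _ \<psi>])
qed

text \<open>For a single part the hypotheses are the eight classical conditions of order four,
  regrouped. \<open>quad\<close> removes the quadrature error at s = 1; \<open>D1\<close> and
  \<open>cD1\<close> remove the quadratic deviations together with the first-order variation of the
  Jacobian; \<open>D2\<close> and \<open>AD1\<close> remove the weighted sum of
  \<open>cubic_term\<close>.\<close>

lemma step_expansion:
  assumes quad: "\<And>k. k < 4 \<Longrightarrow> (\<Sum>i\<in>I. b i * c i ^ k) = 1 / real (Suc k)"
    and D1: "\<And>r. r \<in> Q \<Longrightarrow> (\<Sum>i\<in>I. b i * defect r 1 i) = 0"
    and cD1: "\<And>r. r \<in> Q \<Longrightarrow> (\<Sum>i\<in>I. b i * c i * defect r 1 i) = 0"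
    and D2: "\<And>r. r \<in> Q \<Longrightarrow> (\<Sum>i\<in>I. b i * defect r 2 i) = 0"
    and AD1: "\<And>q r. q \<in> Q \<Longrightarrow> r \<in> Q \<Longrightarrow> (\<Sum>i\<in>I. b i * (\<Sum>m\<in>I. A q i m * defect r 1 m)) = 0"
  shows "vbigo 5 (\<lambda>h. y0 + h *\<^sub>R (\<Sum>q\<in>Q. \<Sum>m\<in>I. b m *\<^sub>R u q (z h m)) - taylor h)"
proof -
  have bE1: "(\<Sum>i\<in>I. b i *\<^sub>R (\<Sum>m\<in>I. A q i m *\<^sub>R defect_term 1 m)) = 0" if "q \<in> Q" for q
  proof -
    have "(\<Sum>i\<in>I. b i *\<^sub>R (\<Sum>m\<in>I. A q i m *\<^sub>R defect_term 1 m)) = (\<Sum>i\<in>I. \<Sum>r\<in>Q. (b i * (\<Sum>m\<in>I. A q i m * defect r 1 m)) *\<^sub>R \<phi> r 1)"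
    proof (rule sum.cong[OF refl])
      fix i
      have "(\<Sum>m\<in>I. A q i m *\<^sub>R defect_term 1 m) = (\<Sum>r\<in>Q. (\<Sum>m\<in>I. A q i m * defect r 1 m) *\<^sub>R \<phi> r 1)"
        unfolding defect_term_def scaleR_sum_right scaleR_sum_left scaleR_scaleR by (rule sum.swap)
      then show "b i *\<^sub>R (\<Sum>m\<in>I. A q i m *\<^sub>R defect_term 1 m) = (\<Sum>r\<in>Q. (b i * (\<Sum>m\<in>I. A q i m * defect r 1 m)) *\<^sub>R \<phi> r 1)"
        by (simp add: scaleR_sum_right)
    qed
    also have "\<dots> = (\<Sum>r\<in>Q. (\<Sum>i\<in>I. b i * (\<Sum>m\<in>I. A q i m * defect r 1 m)) *\<^sub>R \<phi> r 1)"
      unfolding scaleR_sum_left by (rule sum.swap)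
    also have "\<dots> = 0" using AD1[OF that] by simp
    finally show ?thesis .
  qed
  have bF: "(\<Sum>i\<in>I. b i *\<^sub>R cubic_term i) = 0"
  proof -
    have "(\<Sum>i\<in>I. b i *\<^sub>R defect_term 2 i) = (\<Sum>r\<in>Q. (\<Sum>i\<in>I. b i * defect r 2 i) *\<^sub>R \<phi> r 2)"
      unfolding defect_term_def scaleR_sum_right scaleR_sum_left scaleR_scaleR by (rule sum.swap)
    then have 1: "(\<Sum>i\<in>I. b i *\<^sub>R defect_term 2 i) = 0" using D2 by simp
    have "(\<Sum>i\<in>I. b i *\<^sub>R (\<Sum>q\<in>Q. \<Sum>m\<in>I. A q i m *\<^sub>R Du q y0 (defect_term 1 m)))
        = (\<Sum>q\<in>Q. \<Sum>i\<in>I. b i *\<^sub>R (\<Sum>m\<in>I. A q i m *\<^sub>R Du q y0 (defect_term 1 m)))"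
      unfolding scaleR_sum_right[of "b i" for i] by (rule sum.swap)
    also have "\<dots> = (\<Sum>q\<in>Q. Du q y0 (\<Sum>i\<in>I. b i *\<^sub>R (\<Sum>m\<in>I. A q i m *\<^sub>R defect_term 1 m)))"
      by (intro sum.cong refl) (simp add: linear_sum[OF linear_Du] linear_scale[OF linear_Du])
    also have "\<dots> = 0" by (simp add: bE1 linear_0[OF linear_Du] del: One_nat_def)
    finally show ?thesis unfolding cubic_term_def scaleR_add_right sum.distrib using 1 by simp
  qed
  have *: "vbigo 4 (\<lambda>h. \<Sum>m\<in>I. b m *\<^sub>R du q m h)" if q: "q \<in> Q" for q
  proof -
    obtain \<psi> :: "'q \<Rightarrow> nat \<Rightarrow> real^'n" where \<psi>: "\<And>m. m \<in> I \<Longrightarrow> vbigo 4 (\<lambda>h. du q m h - (h^2 *\<^sub>R (\<Sum>r\<in>Q. defect r 1 m *\<^sub>R (\<psi> r 0 + h *\<^sub>R c m *\<^sub>R \<psi> r 1))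
        + h^3 *\<^sub>R Du q y0 (cubic_term m)))"
      using du_4[OF q] by blast
    have 1: "(\<Sum>m\<in>I. b m *\<^sub>R (\<Sum>r\<in>Q. defect r 1 m *\<^sub>R (\<psi> r 0 + h *\<^sub>R c m *\<^sub>R \<psi> r 1))) = 0" for h
    proof -
      have "(\<Sum>m\<in>I. b m *\<^sub>R (\<Sum>r\<in>Q. defect r 1 m *\<^sub>R (\<psi> r 0 + h *\<^sub>R c m *\<^sub>R \<psi> r 1)))
         = (\<Sum>r\<in>Q. \<Sum>m\<in>I. (b m * defect r 1 m) *\<^sub>R \<psi> r 0 + (b m * c m * defect r 1 m) *\<^sub>R (h *\<^sub>R \<psi> r 1))"
        unfolding scaleR_sum_right[of "b m" for m] by (subst sum.swap) (simp add: scaleR_add_right mult_ac)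
      also have "\<dots> = 0"
        by (simp add: sum.distrib D1 cD1 del: One_nat_def scaleR_scaleR flip: scaleR_sum_left)
      finally show ?thesis .
    qed
    have 2: "(\<Sum>m\<in>I. b m *\<^sub>R Du q y0 (cubic_term m)) = 0"
    proof -
      have "(\<Sum>m\<in>I. b m *\<^sub>R Du q y0 (cubic_term m)) = Du q y0 (\<Sum>m\<in>I. b m *\<^sub>R cubic_term m)"
        by (simp add: linear_sum[OF linear_Du[OF q]] linear_scale[OF linear_Du[OF q]])
      then show ?thesis by (simp add: bF linear_0[OF linear_Du[OF q]])
    qed
    have gen: "(\<Sum>m\<in>I. b m *\<^sub>R (v m - (s *\<^sub>R X m + t *\<^sub>R Y m)))
        = (\<Sum>m\<in>I. b m *\<^sub>R v m) - s *\<^sub>R (\<Sum>m\<in>I. b m *\<^sub>R X m) - t *\<^sub>R (\<Sum>m\<in>I. b m *\<^sub>R Y m)"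
      for s t and v X Y :: "'i \<Rightarrow> real^'n"
      by (simp add: scaleR_diff_right scaleR_add_right sum_subtractf sum.distrib scaleR_sum_right mult.commute)
    have "vbigo 4 (\<lambda>h. \<Sum>m\<in>I. b m *\<^sub>R (du q m h - (h^2 *\<^sub>R (\<Sum>r\<in>Q. defect r 1 m *\<^sub>R (\<psi> r 0 + h *\<^sub>R c m *\<^sub>R \<psi> r 1))
        + h^3 *\<^sub>R Du q y0 (cubic_term m))))"
      by (intro vbigo_sum vbigo_scaleR \<psi>)
    moreover have "(\<Sum>m\<in>I. b m *\<^sub>R (du q m h - (h^2 *\<^sub>R (\<Sum>r\<in>Q. defect r 1 m *\<^sub>R (\<psi> r 0 + h *\<^sub>R c m *\<^sub>R \<psi> r 1))
        + h^3 *\<^sub>R Du q y0 (cubic_term m)))) = (\<Sum>m\<in>I. b m *\<^sub>R du q m h)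
        - h^2 *\<^sub>R (\<Sum>m\<in>I. b m *\<^sub>R (\<Sum>r\<in>Q. defect r 1 m *\<^sub>R (\<psi> r 0 + h *\<^sub>R c m *\<^sub>R \<psi> r 1)))
        - h^3 *\<^sub>R (\<Sum>m\<in>I. b m *\<^sub>R Du q y0 (cubic_term m))" for h
      by (rule gen)
    ultimately show ?thesis by (simp only: 1 2 scaleR_zero_right diff_0_right)
  qed
  have 1: "vbigo 5 (\<lambda>h. h *\<^sub>R (\<Sum>q\<in>Q. \<Sum>m\<in>I. b m *\<^sub>R du q m h))"
    using vbigo_Suc_scaleR[OF vbigo_sum[OF *]] by simp
  have quad': "(\<Sum>k<4. h ^ Suc k *\<^sub>R (\<Sum>q\<in>Q. ((\<Sum>m\<in>I. b m * c m ^ k) - 1 ^ Suc k / real (Suc k)) *\<^sub>R \<phi> q k)) = 0" for h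
    using quad by (intro sum.neutral) simp
  show ?thesis
    using vbigo_add[OF quadrature_expansion[of "\<lambda>q. b" 1] 1] unfolding quad' by simp
qed

end

section \<open>The defects of the RMIS coefficients\<close>

text \<open>Stages are numbered from 1 and facts about \<open>(i, 1)\<close> serve as rewrite rules,
  so \<open>1\<close> has to survive simplification instead of becoming
  \<open>Suc 0\<close>.\<close>

declare One_nat_def [simp del]

text \<open>\<open>True\<close> stands for the fast and \<open>False\<close> for the slow part of
  the right-hand side. Slow stage r is represented by \<open>(r, 1)\<close>, so the slow matrix has
  nonzero columns only at first stages.\<close>

definition rmis_ark :: "rk \<Rightarrow> rk \<Rightarrow> bool \<Rightarrow> nat \<times> nat \<Rightarrow> nat \<times> nat \<Rightarrow> real" where
  "rmis_ark TI TO q j m =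
     (if q then rmis_Aff TI TO j m else if snd m = 1 then rmis_Afs TI TO j (fst m) else 0)"

definition rmis_c :: "rk \<Rightarrow> rk \<Rightarrow> nat \<times> nat \<Rightarrow> real" where
  "rmis_c TI TO = (\<lambda>(i, l). rk_c TO i + rmis_dc TO i * rk_c TI l)"

abbreviation rmis_stages :: "rk \<Rightarrow> rk \<Rightarrow> (nat \<times> nat) set" where
  "rmis_stages TI TO \<equiv> {1..rk_s TO} \<times> {1..rk_s TI}"

text \<open>A row acts as a composite rule: the full inner quadrature over each completed block,
  followed by the inner stage rule on the current block.\<close>

lemma sum_rmis_Aff:
  fixes g :: "nat \<times> nat \<Rightarrow> real"
  assumes "i \<in> {1..rk_s TO}"
  shows "(\<Sum>m\<in>rmis_stages TI TO. rmis_Aff TI TO (i, l) m * g m) =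
    (\<Sum>j=1..<i. rmis_dc TO j * (\<Sum>k=1..rk_s TI. rk_b TI k * g (j, k))) +
    rmis_dc TO i * (\<Sum>k=1..rk_s TI. rk_A TI l k * g (i, k))"
proof -
  let ?X = "\<lambda>j. rmis_dc TO j * (\<Sum>k=1..rk_s TI. rk_b TI k * g (j, k))"
  let ?Y = "rmis_dc TO i * (\<Sum>k=1..rk_s TI. rk_A TI l k * g (i, k))"
  have "(\<Sum>m\<in>rmis_stages TI TO. rmis_Aff TI TO (i, l) m * g m) =
      (\<Sum>j=1..rk_s TO. \<Sum>k=1..rk_s TI. rmis_Aff TI TO (i, l) (j, k) * g (j, k))"
    by (simp add: sum.cartesian_product case_prod_unfold)
  also have "\<dots> = (\<Sum>j=1..rk_s TO. (if j < i then ?X j else 0) + (if j = i then ?Y else 0))"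
    by (intro sum.cong refl) (auto simp: rmis_Aff_def sum_distrib_left mult.assoc)
  also have "\<dots> = (\<Sum>j\<in>{j\<in>{1..rk_s TO}. j < i}. ?X j) + ?Y"
    using assms by (simp only: sum.distrib sum.inter_filter[OF finite_atLeastAtMost]) simp
  also have "{j\<in>{1..rk_s TO}. j < i} = {1..<i}" using assms by auto
  finally show ?thesis .
qed

lemma sum_first_stage:
  fixes g :: "nat \<times> nat \<Rightarrow> 'a::comm_monoid_add"
  assumes "1 \<le> rk_s TI"
  shows "(\<Sum>m\<in>rmis_stages TI TO. if snd m = 1 then g m else 0) = (\<Sum>i=1..rk_s TO. g (i, 1))"
proof -
  have "(\<Sum>m\<in>rmis_stages TI TO. if snd m = 1 then g m else 0) =
      (\<Sum>i=1..rk_s TO. \<Sum>k=1..rk_s TI. if k = 1 then g (i, 1) else 0)"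
    unfolding sum.cartesian_product case_prod_unfold by (intro sum.cong refl) auto
  also have "\<dots> = (\<Sum>i=1..rk_s TO. g (i, 1))"
    using assms by (intro sum.cong refl) simp
  finally show ?thesis .
qed

lemma rk_Av_diff: "rk_Av M (\<lambda>i. f i - g i) i = rk_Av M f i - rk_Av M g i"
  by (simp add: rk_Av_def right_diff_distrib sum_subtractf)

lemma rk_Av_divide: "rk_Av M (\<lambda>i. f i / r) i = rk_Av M f i / r"
  by (simp add: rk_Av_def sum_divide_distrib)

text \<open>This is where v^O comes from. The inner sum is twice the trapezoidal rule on the grid of
  outer abscissae up to c_i. With the tail sums B_m of b^O, interchanging summations gives x_i the
  coefficient (c_(i+1) - c_i) B_(i+1) + (c_i - c_(i-1)) B_i, and B_i = b_i + B_(i+1) turns this into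
  v_i.\<close>

lemma rmis_v_sum:
  assumes "x 1 = 0"
  shows "(\<Sum>i=1..rk_s TO. rk_b TO i * (\<Sum>j=1..<i. (rk_c TO (j + 1) - rk_c TO j) * (x j + x (j + 1))))
    = (\<Sum>i=1..rk_s TO. rmis_v TO i * x i)"
proof -
  let ?s = "rk_s TO" and ?c = "rk_c TO" and ?b = "rk_b TO"
  define B where "B m = (\<Sum>i=m..?s. ?b i)" for m
  have B_rec: "B m = ?b m + B (m + 1)" if "m \<le> ?s" for m
    using that by (simp add: B_def sum.atLeast_Suc_atMost Suc_eq_plus1)
  have B_end: "B (1 + ?s) = 0" by (simp add: B_def)
  let ?e = "\<lambda>j. ?c (j + 1) - ?c j"
  have "(\<Sum>i=1..?s. ?b i * (\<Sum>j=1..<i. ?e j * (x j + x (j + 1))))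
      = (\<Sum>i=1..?s. \<Sum>j\<in>{j\<in>{1..<?s}. j < i}. ?b i * (?e j * (x j + x (j + 1))))"
    unfolding sum_distrib_left by (intro sum.cong refl) auto
  also have "\<dots> = (\<Sum>j=1..<?s. \<Sum>i\<in>{i\<in>{1..?s}. j < i}. ?b i * (?e j * (x j + x (j + 1))))"
    by (rule sum.swap_restrict) auto
  also have "\<dots> = (\<Sum>j=1..<?s. B (j + 1) * (?e j * (x j + x (j + 1))))"
    unfolding B_def sum_distrib_right by (intro sum.cong refl) auto
  also have "\<dots> = (\<Sum>j=1..<?s. ?e j * B (j + 1) * x j) + (\<Sum>j=1..<?s. ?e j * B (j + 1) * x (j + 1))"
    unfolding sum.distrib[symmetric] by (intro sum.cong refl) (simp add: algebra_simps)
  \<comment> \<open>Both sums are extended to all indices so that they can be added termwise; the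
    conditionals record that the last index has no right neighbour and the first one no left
    neighbour.\<close>
  also have "(\<Sum>j=1..<?s. ?e j * B (j + 1) * x j) = (\<Sum>i=1..?s. if i < ?s then ?e i * B (i + 1) * x i else 0)"
    by (rule sum.mono_neutral_cong_left) auto
  also have "(\<Sum>j=1..<?s. ?e j * B (j + 1) * x (j + 1)) = (\<Sum>i=1..?s. if 1 < i then ?e (i - 1) * B i * x i else 0)"
  proof -
    have "(\<Sum>j=1..<?s. ?e j * B (j + 1) * x (j + 1)) = (\<Sum>j=1..<?s. ?e (Suc j - 1) * B (Suc j) * x (Suc j))"
      by (simp add: Suc_eq_plus1)
    also have "\<dots> = (\<Sum>i=Suc 1..<Suc ?s. ?e (i - 1) * B i * x i)"
      by (rule sum.shift_bounds_Suc_ivl[symmetric])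
    also have "\<dots> = (\<Sum>i=1..?s. if 1 < i then ?e (i - 1) * B i * x i else 0)"
      by (rule sum.mono_neutral_cong_left) auto
    finally show ?thesis .
  qed
  also have "(\<Sum>i=1..?s. if i < ?s then ?e i * B (i + 1) * x i else 0) + (\<Sum>i=1..?s. if 1 < i then ?e (i - 1) * B i * x i else 0)
      = (\<Sum>i=1..?s. rmis_v TO i * x i)"
    unfolding sum.distrib[symmetric]
  proof (rule sum.cong[OF refl])
    fix i assume i: "i \<in> {1..?s}"
    show "(if i < ?s then ?e i * B (i + 1) * x i else 0) + (if 1 < i then ?e (i - 1) * B i * x i else 0) = rmis_v TO i * x i"
    \<comment> \<open>At the first index the sums produce a coefficient that may differ from v_1 =
      0; the assumption \<open>x 1 = 0\<close> makes this harmless.\<close>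
    proof (cases "i = 1")
      case True
      with assms show ?thesis by (simp add: rmis_v_def)
    next
      case False
      then have "?e (i - 1) = ?c i - ?c (i - 1)" using i by simp
      with False i B_rec[of i] show ?thesis
        by (cases "i < ?s") (auto simp: rmis_v_def B_def[symmetric] algebra_simps B_end)
    qed
  qed
  finally show ?thesis .
qed

text \<open>
  The row sums and order conditions of the additive method with stages \<open>(i, l)\<close>, expressed through
  the defects \<open>D\<close>. Only the first stage of each block has nonzero weight; there the fast defects vanish
  because the inner method integrates quadratics exactly on each block and the block integrals
  telescope. The assumption on $v^O$ enters only in \<open>b_A_D1\<close>, for a fast stage coupled to slow ones.
\<close>

locale rmis_pair =
  fixes TI TO :: rk
  assumes explicit: "rk_explicit TO"
    and c_1: "rk_c TO 1 = 0"
    and order_TI: "rk_order_ge_3 TI"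
    and order_TO: "rk_order_ge_4 TO"
    and row_TI: "rk_row_sum TI"
    and row_TO: "rk_row_sum TO"
    and v_cond: "(\<Sum>i=1..rk_s TO. rmis_v TO i * rk_Av TO (rk_c TO) i) = 1 / 12"
    and inner_c_1: "rk_c TI 1 = 0"
    and inner_A_1: "\<forall>l\<in>{1..rk_s TI}. rk_A TI 1 l = 0"
begin

abbreviation "I \<equiv> rmis_stages TI TO"
abbreviation "A \<equiv> rmis_ark TI TO"
abbreviation "c \<equiv> rmis_c TI TO"
abbreviation "b \<equiv> rmis_bf TO"
abbreviation "D q k j \<equiv> (\<Sum>m\<in>I. A q j m * c m ^ k) - c j ^ Suc k / real (Suc k)"

text \<open>Guarantees that the stages \<open>(i, 1)\<close>, which carry all the weight, exist:
  empty inner weights could not sum to 1.\<close>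

lemma inner_stage: "1 \<le> rk_s TI"
proof (rule ccontr)
  assume "\<not> 1 \<le> rk_s TI"
  then have "(\<Sum>i=1..rk_s TI. rk_b TI i) = 0" by simp
  with order_TI show False by (simp add: rk_order_ge_3_def)
qed

lemma TI_order:
  "(\<Sum>l=1..rk_s TI. rk_b TI l) = 1"
  "(\<Sum>l=1..rk_s TI. rk_b TI l * rk_c TI l) = 1 / 2"
  "(\<Sum>l=1..rk_s TI. rk_b TI l * rk_c TI l ^ 2) = 1 / 3"
  "(\<Sum>l=1..rk_s TI. rk_b TI l * rk_Av TI (rk_c TI) l) = 1 / 6"
  using order_TI by (simp_all add: rk_order_ge_3_def)

lemma TO_order:
  "(\<Sum>i=1..rk_s TO. rk_b TO i) = 1"
  "(\<Sum>i=1..rk_s TO. rk_b TO i * rk_c TO i) = 1 / 2"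
  "(\<Sum>i=1..rk_s TO. rk_b TO i * rk_c TO i ^ 2) = 1 / 3"
  "(\<Sum>i=1..rk_s TO. rk_b TO i * rk_Av TO (rk_c TO) i) = 1 / 6"
  "(\<Sum>i=1..rk_s TO. rk_b TO i * rk_c TO i ^ 3) = 1 / 4"
  "(\<Sum>i=1..rk_s TO. rk_b TO i * rk_c TO i * rk_Av TO (rk_c TO) i) = 1 / 8"
  "(\<Sum>i=1..rk_s TO. rk_b TO i * rk_Av TO (\<lambda>j. rk_c TO j ^ 2) i) = 1 / 12"
  "(\<Sum>i=1..rk_s TO. rk_b TO i * rk_Av TO (rk_Av TO (rk_c TO)) i) = 1 / 24"
  using order_TO by (simp_all add: rk_order_ge_3_def rk_order_ge_4_def)

lemma Av_1: "i \<in> {1..rk_s TO} \<Longrightarrow> rk_Av TO (\<lambda>_. 1) i = rk_c TO i"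
  using row_TO by (simp add: rk_Av_def rk_row_sum_def)

lemma dc_less: "j < rk_s TO \<Longrightarrow> rmis_dc TO j = rk_c TO (j + 1) - rk_c TO j"
  by (simp add: rmis_dc_def)

lemma sum_b: "(\<Sum>m\<in>I. b m * g m) = (\<Sum>i=1..rk_s TO. rk_b TO i * g (i, 1))"
proof -
  have "(\<Sum>m\<in>I. b m * g m) = (\<Sum>m\<in>I. if snd m = 1 then rk_b TO (fst m) * g m else 0)"
    by (intro sum.cong refl) (simp add: rmis_bf_def case_prod_unfold)
  then show ?thesis by (simp add: sum_first_stage[OF inner_stage])
qed

text \<open>Within a block the slow rows interpolate linearly, with parameter c_l of the inner
  method, between row i of A^O and the next row, or b^O in the last block.\<close>

lemma sum_A_slow:
  assumes "i \<in> {1..rk_s TO}"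
  shows "(\<Sum>m\<in>I. A False (i, l) m * g m) = rk_Av TO (\<lambda>r. g (r, 1)) i + rk_c TI l *
    ((if i < rk_s TO then rk_Av TO (\<lambda>r. g (r, 1)) (i + 1) else (\<Sum>r=1..rk_s TO. rk_b TO r * g (r, 1)))
      - rk_Av TO (\<lambda>r. g (r, 1)) i)"
proof -
  have "(\<Sum>m\<in>I. A False (i, l) m * g m) = (\<Sum>m\<in>I. if snd m = 1 then rmis_Afs TI TO (i, l) (fst m) * g m else 0)"
    by (intro sum.cong refl) (simp add: rmis_ark_def)
  also have "\<dots> = (\<Sum>r=1..rk_s TO. rmis_Afs TI TO (i, l) r * g (r, 1))"
    by (simp add: sum_first_stage[OF inner_stage])
  finally show ?thesis
    by (simp add: rmis_Afs_def rk_Av_def algebra_simps sum.distrib sum_subtractf sum_distrib_left)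
qed

lemma c_first: "c (i, 1) = rk_c TO i"
  by (simp add: rmis_c_def inner_c_1)

lemma sum_A_first_fast:
  assumes "i \<in> {1..rk_s TO}"
  shows "(\<Sum>m\<in>I. A True (i, 1) m * g m) = (\<Sum>j=1..<i. rmis_dc TO j * (\<Sum>l=1..rk_s TI. rk_b TI l * g (j, l)))"
  using inner_A_1 by (simp add: rmis_ark_def sum_rmis_Aff[OF assms])

lemma sum_A_first_slow:
  assumes "i \<in> {1..rk_s TO}"
  shows "(\<Sum>m\<in>I. A False (i, 1) m * g m) = rk_Av TO (\<lambda>r. g (r, 1)) i"
  using sum_A_slow[OF assms, of 1 g] by (simp add: inner_c_1)

text \<open>Fast part: the lengths of the completed blocks telescope to c_i since c_1 = 0. Slow
  part: interpolating the row sums c_i and c_(i+1) gives the same point; in the last block the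
  weights b^O contribute the end point 1.\<close>

lemma row_sum:
  assumes "j \<in> I"
  shows "(\<Sum>m\<in>I. A q j m) = c j"
proof -
  obtain i l where j: "j = (i, l)" "i \<in> {1..rk_s TO}" "l \<in> {1..rk_s TI}" using assms by auto
  show ?thesis
  proof (cases q)
    case True
    have "(\<Sum>j=1..<i. rmis_dc TO j) = (\<Sum>j=1..<i. rk_c TO (Suc j) - rk_c TO j)"
      using j by (intro sum.cong refl) (auto simp: dc_less Suc_eq_plus1)
    also have "\<dots> = rk_c TO i" using j c_1 by (subst sum_Suc_diff') auto
    finally have "(\<Sum>j=1..<i. rmis_dc TO j) = rk_c TO i" .
    moreover have "(\<Sum>k=1..rk_s TI. rk_A TI l k) = rk_c TI l"
      using row_TI j by (simp add: rk_row_sum_def)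
    ultimately show ?thesis
      using True sum_rmis_Aff[OF j(2), of TI l "\<lambda>_. 1"] TI_order(1) by (simp add: j rmis_ark_def rmis_c_def)
  next
    case False
    show ?thesis using sum_A_slow[OF j(2), of l "\<lambda>_. 1"] j False
      by (auto simp: Av_1 TO_order rmis_dc_def rmis_c_def algebra_simps)
  qed
qed

text \<open>The inner rule is transplanted affinely to the block from c_j to c_(j+1). The bound on
  \<open>j\<close> makes the right end an outer abscissa; the composite rule ending at c_i runs over
  such blocks only.\<close>

lemma inner_quadrature:
  assumes "k \<le> 2" "j < rk_s TO"
  shows "rmis_dc TO j * (\<Sum>l=1..rk_s TI. rk_b TI l * c (j, l) ^ k) =
    rk_c TO (Suc j) ^ Suc k / real (Suc k) - rk_c TO j ^ Suc k / real (Suc k)"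
proof -
  let ?x = "rk_c TO j" and ?d = "rmis_dc TO j"
  have x: "rk_c TO (Suc j) = ?x + ?d" using dc_less[OF assms(2)] by (simp add: Suc_eq_plus1)
  from assms(1) consider "k = 0" | "k = 1" | "k = 2" by linarith
  then show ?thesis
  proof cases
    case 1
    then show ?thesis by (simp add: x TI_order)
  next
    case 2
    have "(\<Sum>l=1..rk_s TI. rk_b TI l * c (j, l)) =
        ?x * (\<Sum>l=1..rk_s TI. rk_b TI l) + ?d * (\<Sum>l=1..rk_s TI. rk_b TI l * rk_c TI l)"
      unfolding sum_distrib_left sum.distrib[symmetric] by (simp add: rmis_c_def algebra_simps)
    then have "(\<Sum>l=1..rk_s TI. rk_b TI l * c (j, l)) = ?x + ?d / 2" by (simp add: TI_order)
    with 2 show ?thesis by (simp add: x) (simp add: field_simps power2_eq_square)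
  next
    case 3
    have "(\<Sum>l=1..rk_s TI. rk_b TI l * c (j, l) ^ 2) =
        ?x ^ 2 * (\<Sum>l=1..rk_s TI. rk_b TI l) + 2 * ?x * ?d * (\<Sum>l=1..rk_s TI. rk_b TI l * rk_c TI l)
        + ?d ^ 2 * (\<Sum>l=1..rk_s TI. rk_b TI l * rk_c TI l ^ 2)"
      unfolding sum_distrib_left sum.distrib[symmetric] by (simp add: rmis_c_def algebra_simps power2_eq_square)
    then have "(\<Sum>l=1..rk_s TI. rk_b TI l * c (j, l) ^ 2) = ?x ^ 2 + ?x * ?d + ?d ^ 2 / 3" by (simp add: TI_order)
    with 3 show ?thesis by (simp add: x) (simp add: field_simps power2_eq_square power3_eq_cube)
  qed
qed

lemma fast_quadrature:
  assumes "k \<le> 2" "i \<in> {1..rk_s TO}"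
  shows "(\<Sum>j=1..<i. rmis_dc TO j * (\<Sum>l=1..rk_s TI. rk_b TI l * c (j, l) ^ k)) = rk_c TO i ^ Suc k / real (Suc k)"
proof -
  have "(\<Sum>j=1..<i. rmis_dc TO j * (\<Sum>l=1..rk_s TI. rk_b TI l * c (j, l) ^ k)) =
     (\<Sum>j=1..<i. rk_c TO (Suc j) ^ Suc k / real (Suc k) - rk_c TO j ^ Suc k / real (Suc k))"
    using assms by (intro sum.cong refl inner_quadrature) auto
  also have "\<dots> = rk_c TO i ^ Suc k / real (Suc k)"
    using assms c_1 by (subst sum_Suc_diff') auto
  finally show ?thesis .
qed

section \<open>The weighted defect conditions\<close>

lemma D_fast_first: "k \<le> 2 \<Longrightarrow> i \<in> {1..rk_s TO} \<Longrightarrow> D True k (i, 1) = 0"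
  using sum_A_first_fast[of i "\<lambda>m. c m ^ k"] fast_quadrature[of k i] by (simp add: c_first del: One_nat_def)

lemma D_slow_first:
  "i \<in> {1..rk_s TO} \<Longrightarrow> D False k (i, 1) = rk_Av TO (\<lambda>r. rk_c TO r ^ k) i - rk_c TO i ^ Suc k / real (Suc k)"
  using sum_A_first_slow[of i "\<lambda>m. c m ^ k"] by (simp add: c_first del: One_nat_def)

lemma quadrature:
  assumes "k < 4"
  shows "(\<Sum>i\<in>I. b i * c i ^ k) = 1 / real (Suc k)"
proof -
  from assms consider "k = 0" | "k = 1" | "k = 2" | "k = 3" by linarith
  then show ?thesis unfolding sum_b c_first by cases (simp_all add: TO_order)
qed

lemma b_D1: "(\<Sum>i\<in>I. b i * D r 1 i) = 0"
proof (cases r)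
  case True
  then show ?thesis unfolding sum_b by (intro sum.neutral ballI) (simp only: D_fast_first one_le_numeral mult_zero_right)
next
  case False
  then have "(\<Sum>i\<in>I. b i * D r 1 i) = (\<Sum>i=1..rk_s TO. rk_b TO i * rk_Av TO (rk_c TO) i - (rk_b TO i * rk_c TO i ^ 2) / 2)"
    unfolding sum_b by (intro sum.cong refl) (simp only: D_slow_first, simp add: algebra_simps power2_eq_square)
  then show ?thesis by (simp add: sum_subtractf TO_order flip: sum_divide_distrib)
qed

lemma b_c_D1: "(\<Sum>i\<in>I. b i * c i * D r 1 i) = 0"
proof (cases r)
  case True
  then show ?thesis unfolding mult.assoc sum_b by (intro sum.neutral ballI) (simp only: D_fast_first one_le_numeral mult_zero_right)
next
  case False
  then have "(\<Sum>i\<in>I. b i * c i * D r 1 i) = (\<Sum>i=1..rk_s TO. rk_b TO i * rk_c TO i * rk_Av TO (rk_c TO) i - (rk_b TO i * rk_c TO i ^ 3) / 2)"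
    unfolding mult.assoc sum_b
    by (intro sum.cong refl) (simp only: D_slow_first, simp add: c_first algebra_simps power2_eq_square power3_eq_cube)
  then show ?thesis by (simp add: sum_subtractf TO_order flip: sum_divide_distrib)
qed

lemma b_D2: "(\<Sum>i\<in>I. b i * D r 2 i) = 0"
proof (cases r)
  case True
  then show ?thesis unfolding sum_b by (intro sum.neutral ballI) (simp only: D_fast_first order_refl mult_zero_right)
next
  case False
  then have "(\<Sum>i\<in>I. b i * D r 2 i) = (\<Sum>i=1..rk_s TO. rk_b TO i * rk_Av TO (\<lambda>j. rk_c TO j ^ 2) i - (rk_b TO i * rk_c TO i ^ 3) / 3)"
    unfolding sum_b by (intro sum.cong refl) (simp only: D_slow_first, simp add: algebra_simps power2_eq_square power3_eq_cube)
  then show ?thesis by (simp add: sum_subtractf TO_order flip: sum_divide_distrib)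
qed

text \<open>By row-sum consistency the translation to the block drops out and the defect is the
  squared block length times the defect of the inner method. The inner weights annihilate the
  latter, since 1/6 = (1/3)/2.\<close>

lemma inner_D_fast:
  assumes "j \<in> {1..rk_s TO}"
  shows "(\<Sum>l=1..rk_s TI. rk_b TI l * D True 1 (j, l)) = 0"
proof -
  let ?d = "rmis_dc TO j" and ?x = "rk_c TO j"
  have "D True 1 (j, l) = ?d ^ 2 * (rk_Av TI (rk_c TI) l - rk_c TI l ^ 2 / 2)" if "l \<in> {1..rk_s TI}" for l
  proof -
    have "(\<Sum>m\<in>I. A True (j, l) m * c m ^ 1) = ?x ^ 2 / 2 + ?d * (\<Sum>k=1..rk_s TI. rk_A TI l k * c (j, k))"
      using sum_rmis_Aff[OF assms, of TI l c] fast_quadrature[of 1 j] assms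
      by (simp add: rmis_ark_def power2_eq_square)
    also have "(\<Sum>k=1..rk_s TI. rk_A TI l k * c (j, k)) = ?x * (\<Sum>k=1..rk_s TI. rk_A TI l k) + ?d * rk_Av TI (rk_c TI) l"
      unfolding rk_Av_def sum_distrib_left sum.distrib[symmetric] by (simp add: rmis_c_def algebra_simps)
    also have "(\<Sum>k=1..rk_s TI. rk_A TI l k) = rk_c TI l"
      using row_TI that by (simp add: rk_row_sum_def)
    finally show ?thesis by (simp add: rmis_c_def power2_eq_square field_simps)
  qed
  then have "(\<Sum>l=1..rk_s TI. rk_b TI l * D True 1 (j, l)) =
      ?d ^ 2 * ((\<Sum>l=1..rk_s TI. rk_b TI l * rk_Av TI (rk_c TI) l) - (\<Sum>l=1..rk_s TI. rk_b TI l * rk_c TI l ^ 2) / 2)"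
    unfolding sum_divide_distrib sum_subtractf[symmetric] sum_distrib_left
    by (intro sum.cong refl) (simp only:, simp add: algebra_simps)
  then show ?thesis by (simp only: TI_order) simp
qed

text \<open>The inner weights have mean abscissa 1/2, so the linear interpolant of A^O c^O over the
  block integrates to the trapezoidal value. The subtracted term is the exact integral of t^2/2 over
  the block.\<close>

lemma inner_D_slow:
  assumes "j \<in> {1..<rk_s TO}"
  shows "rmis_dc TO j * (\<Sum>l=1..rk_s TI. rk_b TI l * D False 1 (j, l)) =
    (rk_c TO (j + 1) - rk_c TO j) * (rk_Av TO (rk_c TO) j + rk_Av TO (rk_c TO) (j + 1)) / 2
    - (rk_c TO (Suc j) ^ 3 / 6 - rk_c TO j ^ 3 / 6)"
proof -
  let ?d = "rmis_dc TO j" and ?u = "rk_Av TO (rk_c TO)"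
  have "D False 1 (j, l) = ?u j + rk_c TI l * (?u (j + 1) - ?u j) - c (j, l) ^ 2 / 2" for l
    using sum_A_slow[of j l c] assms by (simp add: c_first power2_eq_square del: One_nat_def)
  then have "(\<Sum>l=1..rk_s TI. rk_b TI l * D False 1 (j, l)) =
      (\<Sum>l=1..rk_s TI. rk_b TI l * ?u j + (rk_b TI l * rk_c TI l) * (?u (j + 1) - ?u j) - (rk_b TI l * c (j, l) ^ 2) / 2)"
    by (intro sum.cong refl) (simp only:, simp add: algebra_simps)
  also have "\<dots> = ?u j + (?u (j + 1) - ?u j) / 2 - (\<Sum>l=1..rk_s TI. rk_b TI l * c (j, l) ^ 2) / 2"
    by (simp add: sum_subtractf sum.distrib TI_order flip: sum_divide_distrib sum_distrib_right)
  finally have 1: "(\<Sum>l=1..rk_s TI. rk_b TI l * D False 1 (j, l)) =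
      ?u j + (?u (j + 1) - ?u j) / 2 - (\<Sum>l=1..rk_s TI. rk_b TI l * c (j, l) ^ 2) / 2" .
  have 2: "?d * (\<Sum>l=1..rk_s TI. rk_b TI l * c (j, l) ^ 2) = rk_c TO (Suc j) ^ 3 / 3 - rk_c TO j ^ 3 / 3"
    using inner_quadrature[of 2 j] assms by (simp add: power3_eq_cube power2_eq_square)
  have 3: "?d = rk_c TO (j + 1) - rk_c TO j" using assms by (simp add: dc_less)
  \<comment> \<open>The algebra is isolated over plain reals, with \<open>X\<close> and
    \<open>Y\<close> standing for the inner sums, which are to be treated as atoms.\<close>
  have "d * X = e * (v + w) / 2 - (p / 6 - p' / 6)"
    if "X = v + (w - v) / 2 - Y / 2" "d * Y = p / 3 - p' / 3" "d = e" for d X Y v w p p' e :: real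
  proof -
    have "d * X = d * (v + w) / 2 - (d * Y) / 2" unfolding that(1) by (simp add: field_simps)
    then show ?thesis unfolding that(2) by (simp add: that(3) diff_divide_distrib)
  qed
  from this[OF 1 2 3] show ?thesis .
qed

text \<open>Here \<open>q\<close> selects the coupling matrix and \<open>r\<close> the defect it
  acts on. Slow coupling sees only first stages, where fast defects vanish and slow ones are those
  of the outer method. Fast coupling integrates the defects over whole blocks by the inner weights,
  which leaves nothing of the fast defects and a trapezoidal error of the slow ones.\<close>

lemma b_A_D1: "(\<Sum>i\<in>I. b i * (\<Sum>m\<in>I. A q i m * D r 1 m)) = 0"
proof -
  let ?u = "rk_Av TO (rk_c TO)"
  consider "\<not> q" r | "\<not> q" "\<not> r" | q r | q "\<not> r" by blast
  then show ?thesis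
  proof cases
    case 1
    have "rk_Av TO (\<lambda>i. D r 1 (i, 1)) i = 0" for i
      unfolding rk_Av_def using 1 by (intro sum.neutral ballI) (simp only: D_fast_first one_le_numeral mult_zero_right)
    with 1 show ?thesis unfolding sum_b by (intro sum.neutral ballI) (simp only: sum_A_first_slow mult_zero_right)
  next
    case 2
    have "rk_Av TO (\<lambda>i. D r 1 (i, 1)) i = rk_Av TO ?u i - rk_Av TO (\<lambda>j. rk_c TO j ^ 2) i / 2" for i
    proof -
      have "rk_Av TO (\<lambda>i. D r 1 (i, 1)) i = rk_Av TO (\<lambda>i. ?u i - rk_c TO i ^ 2 / 2) i"
        unfolding rk_Av_def[of TO _ i] using 2 by (intro sum.cong refl) (simp only: D_slow_first, simp add: power2_eq_square)
      then show ?thesis by (simp only: rk_Av_diff rk_Av_divide)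
    qed
    with 2 have "(\<Sum>i\<in>I. b i * (\<Sum>m\<in>I. A q i m * D r 1 m)) =
        (\<Sum>i=1..rk_s TO. rk_b TO i * rk_Av TO ?u i - (rk_b TO i * rk_Av TO (\<lambda>j. rk_c TO j ^ 2) i) / 2)"
      unfolding sum_b by (intro sum.cong refl) (simp only: sum_A_first_slow, simp add: algebra_simps)
    then show ?thesis by (simp add: sum_subtractf TO_order flip: sum_divide_distrib)
  next
    case 3
    have "(\<Sum>j=1..<i. rmis_dc TO j * (\<Sum>l=1..rk_s TI. rk_b TI l * D r 1 (j, l))) = 0" if "i \<in> {1..rk_s TO}" for i
    proof (intro sum.neutral ballI)
      fix j assume "j \<in> {1..<i}"
      with that have "j \<in> {1..rk_s TO}" by simp
      from inner_D_fast[OF this] 3(2)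
      show "rmis_dc TO j * (\<Sum>l=1..rk_s TI. rk_b TI l * D r 1 (j, l)) = 0" by (simp only: mult_zero_right)
    qed
    with 3 show ?thesis unfolding sum_b by (intro sum.neutral ballI) (simp only: sum_A_first_fast mult_zero_right)
  next
    case 4
    \<comment> \<open>Twice the trapezoidal sum of A^O c^O up to c_i, in the form required by
      \<open>rmis_v_sum\<close>.\<close>
    let ?w = "\<lambda>i. \<Sum>j=1..<i. (rk_c TO (j + 1) - rk_c TO j) * (?u j + ?u (j + 1))"
    have "(\<Sum>j=1..<i. rmis_dc TO j * (\<Sum>l=1..rk_s TI. rk_b TI l * D r 1 (j, l))) = ?w i / 2 - rk_c TO i ^ 3 / 6"
      if i: "i \<in> {1..rk_s TO}" for i
    proof -
      have "(\<Sum>j=1..<i. rmis_dc TO j * (\<Sum>l=1..rk_s TI. rk_b TI l * D r 1 (j, l))) =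
        (\<Sum>j=1..<i. (rk_c TO (j + 1) - rk_c TO j) * (?u j + ?u (j + 1)) / 2 - (rk_c TO (Suc j) ^ 3 / 6 - rk_c TO j ^ 3 / 6))"
      proof (rule sum.cong[OF refl])
        fix j assume "j \<in> {1..<i}"
        with i have "j \<in> {1..<rk_s TO}" by simp
        from inner_D_slow[OF this] 4(2)
        show "rmis_dc TO j * (\<Sum>l=1..rk_s TI. rk_b TI l * D r 1 (j, l)) =
          (rk_c TO (j + 1) - rk_c TO j) * (?u j + ?u (j + 1)) / 2 - (rk_c TO (Suc j) ^ 3 / 6 - rk_c TO j ^ 3 / 6)"
          by (simp only:)
      qed
      also have "\<dots> = ?w i / 2 - (\<Sum>j=1..<i. rk_c TO (Suc j) ^ 3 / 6 - rk_c TO j ^ 3 / 6)"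
        unfolding sum_divide_distrib by (rule sum_subtractf)
      also have "(\<Sum>j=1..<i. rk_c TO (Suc j) ^ 3 / 6 - rk_c TO j ^ 3 / 6) = rk_c TO i ^ 3 / 6"
        using i c_1 by (subst sum_Suc_diff') auto
      finally show ?thesis .
    qed
    with 4 have "(\<Sum>i\<in>I. b i * (\<Sum>m\<in>I. A q i m * D r 1 m)) =
        (\<Sum>i=1..rk_s TO. (rk_b TO i * ?w i) / 2 - (rk_b TO i * rk_c TO i ^ 3) / 6)"
      unfolding sum_b by (intro sum.cong refl) (simp only: sum_A_first_fast, simp add: algebra_simps)
    also have "\<dots> = (\<Sum>i=1..rk_s TO. rk_b TO i * ?w i) / 2 - (\<Sum>i=1..rk_s TO. rk_b TO i * rk_c TO i ^ 3) / 6"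
      unfolding sum_divide_distrib by (rule sum_subtractf)
    also have "(\<Sum>i=1..rk_s TO. rk_b TO i * ?w i) = 1 / 12"
    proof (cases "1 \<le> rk_s TO")
      case True
      \<comment> \<open>Explicitness of the outer method makes the first entry of A^O c^O vanish,
        which is the hypothesis of \<open>rmis_v_sum\<close>.\<close>
      then have "?u 1 = 0" using explicit by (auto simp: rk_Av_def rk_explicit_def intro!: sum.neutral)
      from rmis_v_sum[of ?u, OF this] v_cond show ?thesis by (simp only:)
    next
      case False
      then show ?thesis using TO_order(1) by simp
    qed
    \<comment> \<open>The balance behind the value 1/12: both terms equal 1/24, as sum b c^3 =
      1/4.\<close>
    also have "1 / 12 / 2 - (\<Sum>i=1..rk_s TO. rk_b TO i * rk_c TO i ^ 3) / 6 = 0" by (simp add: TO_order)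
    finally show ?thesis .
  qed
qed

end

section \<open>The local error of the RMIS method\<close>

context rmis_pair
begin

section \<open>Equivalence of the GARK method with the additive method on the fast stages\<close>

lemma sum_ark_Afs:
  fixes g :: "nat \<times> nat \<Rightarrow> 'a::real_vector"
  shows "(\<Sum>m\<in>I. A False j m *\<^sub>R g m) = (\<Sum>r=1..rk_s TO. rmis_Afs TI TO j r *\<^sub>R g (r, 1))"
proof -
  have "(\<Sum>m\<in>I. A False j m *\<^sub>R g m) = (\<Sum>m\<in>I. if snd m = 1 then rmis_Afs TI TO j (fst m) *\<^sub>R g m else 0)"
    by (intro sum.cong refl) (simp add: rmis_ark_def)
  then show ?thesis by (simp add: sum_first_stage[OF inner_stage])
qed

lemma stage_rhs:
  fixes kf :: "nat \<times> nat \<Rightarrow> real^'n" and ff fs :: "real^'n \<Rightarrow> real^'n"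
  shows "y0 + h *\<^sub>R (\<Sum>q\<in>UNIV. \<Sum>m\<in>I. A q j m *\<^sub>R (if q then ff else fs) (kf m)) =
    y0 + h *\<^sub>R (\<Sum>m\<in>I. rmis_Aff TI TO j m *\<^sub>R ff (kf m))
       + h *\<^sub>R (\<Sum>r=1..rk_s TO. rmis_Afs TI TO j r *\<^sub>R fs (kf (r, 1)))"
  unfolding UNIV_bool
  by (simp add: sum_ark_Afs[of j "\<lambda>m. fs (kf m)"] scaleR_add_right) (simp add: rmis_ark_def)

text \<open>Slow stage i uses exactly the completed blocks before i. Fast stage
  \<open>(i, 1)\<close> uses the same ones, since the zero first row of A^I removes the contribution
  of its own block.\<close>

lemma Asf_eq_Aff: "i \<in> {1..rk_s TO} \<Longrightarrow> m \<in> I \<Longrightarrow> rmis_Asf TI TO i m = rmis_Aff TI TO (i, 1) m"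
  using inner_A_1 by (cases m) (auto simp: rmis_Asf_def rmis_Aff_def rmis_g_def)

lemma Ass_eq_Afs: "rk_A TO i r = rmis_Afs TI TO (i, 1) r"
  by (simp add: rmis_Afs_def inner_c_1)

lemma slow_rhs:
  fixes kf :: "nat \<times> nat \<Rightarrow> real^'n" and ff fs :: "real^'n \<Rightarrow> real^'n"
  assumes "i \<in> {1..rk_s TO}"
  shows "y0 + h *\<^sub>R (\<Sum>m\<in>I. rmis_Asf TI TO i m *\<^sub>R ff (kf m)) + h *\<^sub>R (\<Sum>r=1..rk_s TO. rk_A TO i r *\<^sub>R fs (ks r))
    = y0 + h *\<^sub>R (\<Sum>m\<in>I. rmis_Aff TI TO (i, 1) m *\<^sub>R ff (kf m)) + h *\<^sub>R (\<Sum>r=1..rk_s TO. rmis_Afs TI TO (i, 1) r *\<^sub>R fs (ks r))"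
  using Asf_eq_Aff[OF assms] by (simp only: Ass_eq_Afs cong: sum.cong)

text \<open>Both directions matter: the reverse one turns a solution of the additive method into
  GARK stages, the forward one brings an arbitrary GARK stage family into reach of the
  expansion.\<close>

lemma gark_stages_iff:
  fixes ff fs :: "real^'n \<Rightarrow> real^'n"
  shows "gark_stages (rmis TI TO b) ff fs h y0 kf ks \<longleftrightarrow>
    (\<forall>i\<in>{1..rk_s TO}. ks i = kf (i, 1)) \<and>
    (\<forall>j\<in>I. kf j = y0 + h *\<^sub>R (\<Sum>q\<in>UNIV. \<Sum>m\<in>I. A q j m *\<^sub>R (if q then ff else fs) (kf m)))"
    (is "?L \<longleftrightarrow> ?R1 \<and> ?R2")
proof -
  let ?f = "\<lambda>j. y0 + h *\<^sub>R (\<Sum>m\<in>I. rmis_Aff TI TO j m *\<^sub>R ff (kf m)) + h *\<^sub>R (\<Sum>r=1..rk_s TO. rmis_Afs TI TO j r *\<^sub>R fs (ks r))"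
  have L: "?L \<longleftrightarrow> (\<forall>j\<in>I. kf j = ?f j) \<and> (\<forall>i\<in>{1..rk_s TO}. ks i = ?f (i, 1))"
    unfolding gark_stages_def rmis_def gark.simps
    by (intro arg_cong2[where f = "(\<and>)"] refl ball_cong arg_cong2[where f = "(=)"] slow_rhs)
  let ?g = "\<lambda>j. y0 + h *\<^sub>R (\<Sum>q\<in>UNIV. \<Sum>m\<in>I. A q j m *\<^sub>R (if q then ff else fs) (kf m))"
  have fg: "?f j = ?g j" if ?R1 for j
  proof -
    have "(\<Sum>r=1..rk_s TO. rmis_Afs TI TO j r *\<^sub>R fs (ks r)) = (\<Sum>r=1..rk_s TO. rmis_Afs TI TO j r *\<^sub>R fs (kf (r, 1)))"
      using that by (intro sum.cong refl) simp
    then show ?thesis unfolding stage_rhs by (simp only:)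
  qed
  have first: "(i, 1) \<in> I" if "i \<in> {1..rk_s TO}" for i using that inner_stage by simp
  show ?thesis
  proof
    assume l: ?L
    have ?R1
    proof
      fix i assume i: "i \<in> {1..rk_s TO}"
      from l have "ks i = ?f (i, 1)" unfolding L using i by (rule conjunct2[THEN bspec])
      moreover from l have "kf (i, 1) = ?f (i, 1)" unfolding L using first[OF i] by (rule conjunct1[THEN bspec])
      ultimately show "ks i = kf (i, 1)" by (rule trans[OF _ sym])
    qed
    moreover have ?R2
    proof
      fix j assume j: "j \<in> I"
      from l have "kf j = ?f j" unfolding L using j by (rule conjunct1[THEN bspec])
      then show "kf j = ?g j" unfolding fg[OF \<open>?R1\<close>] .
    qed
    ultimately show "?R1 \<and> ?R2" ..
  next
    assume r: "?R1 \<and> ?R2"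
    then have R1: ?R1 and R2: ?R2 by (rule conjunct1, rule conjunct2)
    have "ks i = ?g (i, 1)" if "i \<in> {1..rk_s TO}" for i
      using bspec[OF R1 that] bspec[OF R2 first[OF that]] by (rule trans)
    with R2 show ?L unfolding L fg[OF R1] by blast
  qed
qed

lemma step_eq:
  fixes ff fs :: "real^'n \<Rightarrow> real^'n"
  assumes "\<forall>i\<in>{1..rk_s TO}. ks i = kf (i, 1)"
  shows "gark_step (rmis TI TO b) ff fs h y0 kf ks =
    y0 + h *\<^sub>R (\<Sum>q\<in>UNIV. \<Sum>m\<in>I. b m *\<^sub>R (if q then ff else fs) (kf m))"
proof -
  have "(\<Sum>m\<in>I. b m *\<^sub>R fs (kf m)) = (\<Sum>m\<in>I. if snd m = 1 then rk_b TO (fst m) *\<^sub>R fs (kf m) else 0)"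
    by (intro sum.cong refl) (simp add: rmis_bf_def case_prod_unfold)
  also have "\<dots> = (\<Sum>i=1..rk_s TO. rk_b TO i *\<^sub>R fs (ks i))"
    using assms by (simp add: sum_first_stage[OF inner_stage])
  finally show ?thesis by (simp add: gark_step_def rmis_def UNIV_bool scaleR_add_right)
qed

lemma finite_I: "finite I"
  by simp

lemma rmis_F: "gark_F (rmis TI TO b) = I" and rmis_S: "gark_S (rmis TI TO b) = {1..rk_s TO}"
  by (simp_all add: rmis_def)

lemma gark_accurate_rmis: "gark_accurate TYPE('n::finite) 4 (rmis TI TO b)"
  unfolding gark_accurate_def
\<comment> \<open>Class C^4 suffices: the solution then has five derivatives, and the directional
  derivatives of the right-hand side are of class C^3, more than the second-order expansion in
  \<open>du_4\<close> asks for.\<close>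
proof (intro exI[of _ 4] allI impI)
  fix ff fs :: "real^'n \<Rightarrow> real^'n" and y :: "real \<Rightarrow> real^'n" and t0 d :: real
  assume smooth: "C_diff 4 ff" "C_diff 4 fs" and d: "0 < d"
    and y: "\<forall>t\<in>{t0..t0 + d}. (y has_vector_derivative (ff (y t) + fs (y t))) (at t within {t0..t0 + d})"
  let ?u = "\<lambda>q. if q then ff else fs"
  let ?y0 = "y t0"
  have u: "C_diff 4 (?u q)" for q using smooth by simp
  have u1: "C_diff (Suc 0) (?u q)" for q by (rule C_diff_mono[OF _ u]) simp
  obtain z where z: "\<forall>\<^sub>F h in at_right 0. \<forall>j\<in>I. z h j = ?y0 + h *\<^sub>R (\<Sum>q\<in>UNIV. \<Sum>m\<in>I. A q j m *\<^sub>R ?u q (z h m))"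
    "\<forall>j\<in>I. ((\<lambda>h. z h j) \<longlongrightarrow> ?y0) (at_right 0)"
    using ark_stages_exist[where Q = "UNIV :: bool set" and I = I and u = ?u and A = A, OF finite finite_I u1, of ?y0] by (elim exE conjE) (rule that)
  have "gark_stage_family (rmis TI TO b) ff fs ?y0 z (\<lambda>h i. z h (i, 1))"
    unfolding gark_stage_family_def gark_stages_iff rmis_F rmis_S
  proof (intro conjI ballI)
    show "\<forall>\<^sub>F h in at_right 0. (\<forall>i\<in>{1..rk_s TO}. z h (i, 1) = z h (i, 1)) \<and>
        (\<forall>j\<in>I. z h j = ?y0 + h *\<^sub>R (\<Sum>q\<in>UNIV. \<Sum>m\<in>I. A q j m *\<^sub>R ?u q (z h m)))"
      using z(1) by eventually_elim blast
    show "((\<lambda>h. z h j) \<longlongrightarrow> ?y0) (at_right 0)" if "j \<in> I" for j using z(2) that by blast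
    show "((\<lambda>h. z h (i, 1)) \<longlongrightarrow> ?y0) (at_right 0)" if "i \<in> {1..rk_s TO}" for i
      using z(2) that inner_stage by auto
  qed
  then have ex: "\<exists>kf ks. gark_stage_family (rmis TI TO b) ff fs ?y0 kf ks" by blast

  \<comment> \<open>Time is shifted so that the solution starts at 0, the point of all
    expansions.\<close>
  let ?Y = "\<lambda>t. y (t0 + t)"
  have "(?Y has_vector_derivative (\<Sum>q\<in>UNIV. ?u q (?Y t))) (at t within {0..d})" if "t \<in> {0..d}" for t
  proof -
    have img: "(+) t0 ` {0..d} = {t0..t0 + d}" by simp
    have "((+) t0 has_vector_derivative 1) (at t within {0..d})"
      by (auto intro!: derivative_eq_intros)
    moreover have "(y has_vector_derivative (ff (?Y t) + fs (?Y t))) (at (t0 + t) within (+) t0 ` {0..d})"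
      unfolding img using y that by simp
    ultimately have "(y \<circ> (+) t0 has_vector_derivative 1 *\<^sub>R (ff (?Y t) + fs (?Y t))) (at t within {0..d})"
      by (rule vector_diff_chain_within)
    then show ?thesis by (simp add: o_def UNIV_bool add.commute)
  qed
  from solution_expansion[where u = ?u and Q = UNIV, OF u d this] obtain a \<phi> where a0: "a 0 = ?y0"
    and aS: "\<And>k. k < 4 \<Longrightarrow> a (Suc k) = inverse (real (Suc k)) *\<^sub>R (\<Sum>q\<in>UNIV. \<phi> q k)"
    and YP: "vbigo 5 (\<lambda>h. ?Y h - (\<Sum>j<5. h ^ j *\<^sub>R a j))"
    and \<phi>: "\<And>q s. vbigo 4 (\<lambda>h. ?u q (\<Sum>j<5. (s * h) ^ j *\<^sub>R a j) - (\<Sum>k<4. h ^ k *\<^sub>R (s ^ k *\<^sub>R \<phi> q k)))"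
    by auto
  have "(\<lambda>h. norm (gark_step (rmis TI TO b) ff fs h ?y0 (kf h) (ks h) - y (t0 + h))) \<in> O[at_right 0](\<lambda>h. h ^ (4 + 1))"
    if fam: "gark_stage_family (rmis TI TO b) ff fs ?y0 kf ks" for kf ks
  proof -
    have st: "\<forall>\<^sub>F h in at_right 0. (\<forall>i\<in>{1..rk_s TO}. ks h i = kf h (i, 1)) \<and>
        (\<forall>j\<in>I. kf h j = ?y0 + h *\<^sub>R (\<Sum>q\<in>UNIV. \<Sum>m\<in>I. A q j m *\<^sub>R ?u q (kf h m)))"
      using fam unfolding gark_stage_family_def gark_stages_iff by blast
    \<comment> \<open>The error bound is claimed for every stage family, so the expansion is
      instantiated with the given \<open>kf\<close> and not with the family \<open>z\<close>
      constructed for existence.\<close>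
    interpret ark: ark_expansion UNIV I A b c ?u ?y0 a \<phi> kf
    proof
      show "\<forall>\<^sub>F h in at_right 0. \<forall>j\<in>I. kf h j = ?y0 + h *\<^sub>R (\<Sum>q\<in>UNIV. \<Sum>m\<in>I. A q j m *\<^sub>R ?u q (kf h m))"
        using st by eventually_elim blast
      show "((\<lambda>h. kf h j) \<longlongrightarrow> ?y0) (at_right 0)" if "j \<in> I" for j
        using fam that unfolding gark_stage_family_def rmis_F by blast
    qed (use u row_sum a0 aS \<phi> in \<open>simp_all\<close>)
    have 1: "vbigo 5 (\<lambda>h. ?y0 + h *\<^sub>R (\<Sum>q\<in>UNIV. \<Sum>m\<in>I. b m *\<^sub>R ?u q (kf h m)) - ark.taylor h)"
      using quadrature b_D1 b_c_D1 b_D2 b_A_D1 by (intro ark.step_expansion) (simp_all add: ark.defect_def)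
    have "vbigo 5 (\<lambda>h. gark_step (rmis TI TO b) ff fs h ?y0 (kf h) (ks h) - y (t0 + h))"
    proof (rule vbigo_cong[OF vbigo_diff[OF 1 YP[folded ark.taylor_def]]])
      show "\<forall>\<^sub>F h in at_right 0. gark_step (rmis TI TO b) ff fs h ?y0 (kf h) (ks h) - y (t0 + h) =
          ?y0 + h *\<^sub>R (\<Sum>q\<in>UNIV. \<Sum>m\<in>I. b m *\<^sub>R ?u q (kf h m)) - ark.taylor h - (?Y h - ark.taylor h)"
        using st
      proof eventually_elim
        case (elim h)
        from step_eq[OF conjunct1[OF elim]] show ?case by simp
      qed
    qed
    then obtain C where "\<forall>\<^sub>F h in at_right 0. norm (gark_step (rmis TI TO b) ff fs h ?y0 (kf h) (ks h) - y (t0 + h)) \<le> C * h ^ 5"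
      unfolding vbigo_def by blast
    with eventually_small have "\<forall>\<^sub>F h in at_right 0. norm (norm (gark_step (rmis TI TO b) ff fs h ?y0 (kf h) (ks h) - y (t0 + h))) \<le> C * norm (h ^ (4 + 1))"
      by eventually_elim simp
    then show ?thesis by (rule bigoI)
  qed
  with ex show "(\<exists>kf ks. gark_stage_family (rmis TI TO b) ff fs ?y0 kf ks) \<and>
      (\<forall>kf ks. gark_stage_family (rmis TI TO b) ff fs ?y0 kf ks \<longrightarrow>
        (\<lambda>h. norm (gark_step (rmis TI TO b) ff fs h ?y0 (kf h) (ks h) - y (t0 + h))) \<in> O[at_right 0](\<lambda>h. h ^ (4 + 1)))"
    by blast
qed

end

theorem theorem2:
  fixes TI TO :: rk
  assumes "rk_explicit TO"
    and "rk_c TO 1 = 0"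
    and "\<forall>i\<in>{1..rk_s TO}. \<forall>j\<in>{1..rk_s TO}. i < j \<longrightarrow> rk_c TO i \<le> rk_c TO j"
    and "rk_c TO (rk_s TO) \<le> 1"
    and "rk_order_ge_3 TI"
    and "rk_order_ge_4 TO"
    and "rk_row_sum TI"
    and "rk_row_sum TO"
    and "(\<Sum>i=1..rk_s TO. rmis_v TO i * rk_Av TO (rk_c TO) i) = 1 / 12"
    and "rk_c TI 1 = 0"
    and "\<forall>l\<in>{1..rk_s TI}. rk_A TI 1 l = 0"
  shows "gark_accurate TYPE('n::finite) 4 (rmis TI TO (rmis_bf TO))"
proof -
  interpret rmis_pair TI TO by unfold_locales (fact assms)+
  show ?thesis by (rule gark_accurate_rmis)
qed

end
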